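(* Let $T_{X_1}$ and $T_{X_2}$ be commuting contractions that are Varopoulos operators of type II and order $2$. Then $\|P(T_{X_1},T_{X_2})\|\le\|P\|^{\mathrm{op}}_{\mathbb{D}^2,\infty}$ for any matrix-valued polynomial $P$ in two variables.
   Context: For a separable complex Hilbert space $\mathbb{H}$ and $X\in\mathcal{B}(\mathbb{H})$, the Varopoulos operator of type II and order $2$ is $T_X=\begin{pmatrix}0&X&0\\0&0&X\\0&0&0\end{pmatrix}\in\mathcal{B}(\mathbb{H}\otimes\mathbb{C}^3)$. Here $X_1,X_2$ are operators on the same $\mathbb{H}$ (they are commuting contractions). A matrix-valued polynomial is $P(z_1,z_2)=\sum_{p,q}A_{pq}z_1^pz_2^q$ (finite sum) with $A_{pq}\in M_l$ for some $l\in\mathbb{N}$; $P(T_1,T_2)=\sum_{p,q}A_{pq}\otimes T_1^pT_2^q$; and $\|P\|^{\mathrm{op}}_{\mathbb{D}^2,\infty}=\sup_{z\in\mathbb{D}^2}\|P(z)\|_{op}$. *)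

theory Defs
  imports "HOL-Analysis.Analysis" "HOL-Library.Poly_Mapping"
begin

section \<open>Complex Hilbert spaces\<close>

text \<open>The complex inner product is linear in its first argument. Its real part is required to be
  the library's real inner product, so that the norm is the one induced by \<open>cinner\<close>.\<close>

class complex_inner = real_inner +
  fixes scaleC :: "complex \<Rightarrow> 'a \<Rightarrow> 'a"  (infixr \<open>*\<^sub>C\<close> 75)
    and cinner :: "'a \<Rightarrow> 'a \<Rightarrow> complex"
  assumes scaleC_add_right: "a *\<^sub>C (x + y) = a *\<^sub>C x + a *\<^sub>C y"
    and scaleC_add_left: "(a + b) *\<^sub>C x = a *\<^sub>C x + b *\<^sub>C x"
    and scaleC_scaleC: "a *\<^sub>C b *\<^sub>C x = (a * b) *\<^sub>C x"
    and scaleC_of_real: "complex_of_real r *\<^sub>C x = r *\<^sub>R x"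
    and cinner_commute: "cinner x y = cnj (cinner y x)"
    and cinner_add_left: "cinner (x + y) z = cinner x z + cinner y z"
    and cinner_scaleC_left: "cinner (a *\<^sub>C x) y = a * cinner x y"
    and Re_cinner: "Re (cinner x y) = inner x y"

class chilbert_space = complex_inner + complete_space

lemma norm_eq_sqrt_cinner: "norm x = sqrt (Re (cinner x x))"
  by (simp add: Re_cinner norm_eq_sqrt_inner)

instantiation complex :: chilbert_space
begin

definition scaleC_complex :: "complex \<Rightarrow> complex \<Rightarrow> complex"
  where "scaleC_complex a x = a * x"

definition cinner_complex :: "complex \<Rightarrow> complex \<Rightarrow> complex"
  where "cinner_complex x y = x * cnj y"

instance
  by standard
    (auto simp: scaleC_complex_def cinner_complex_def inner_complex_def algebra_simps scaleR_conv_of_real)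

end

text \<open>\<open>'a ^ 'n\<close> is the Hilbert sum of \<open>CARD('n)\<close> copies of \<open>'a\<close>, that is, the
  tensor product of \<open>'a\<close> with \<open>\<complex>\<^sup>n\<close>.\<close>

instantiation vec :: (complex_inner, finite) complex_inner
begin

definition scaleC_vec :: "complex \<Rightarrow> 'a ^ 'b \<Rightarrow> 'a ^ 'b"
  where "scaleC_vec a x = (\<chi> i. a *\<^sub>C (x $ i))"

definition cinner_vec :: "'a ^ 'b \<Rightarrow> 'a ^ 'b \<Rightarrow> complex"
  where "cinner_vec x y = (\<Sum>i\<in>UNIV. cinner (x $ i) (y $ i))"

instance
proof
  fix a b :: complex and r :: real and x y z :: "'a ^ 'b"
  show "a *\<^sub>C (x + y) = a *\<^sub>C x + a *\<^sub>C y"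
    by (simp add: scaleC_vec_def vec_eq_iff scaleC_add_right)
  show "(a + b) *\<^sub>C x = a *\<^sub>C x + b *\<^sub>C x"
    by (simp add: scaleC_vec_def vec_eq_iff scaleC_add_left)
  show "a *\<^sub>C b *\<^sub>C x = (a * b) *\<^sub>C x"
    by (simp add: scaleC_vec_def vec_eq_iff scaleC_scaleC)
  show "complex_of_real r *\<^sub>C x = r *\<^sub>R x"
    by (simp add: scaleC_vec_def vec_eq_iff scaleC_of_real)
  show "cinner x y = cnj (cinner y x)"
    unfolding cinner_vec_def cnj_sum by (intro sum.cong refl cinner_commute)
  show "cinner (x + y) z = cinner x z + cinner y z"
    by (simp add: cinner_vec_def cinner_add_left sum.distrib)
  show "cinner (a *\<^sub>C x) y = a * cinner x y"
    by (simp add: cinner_vec_def scaleC_vec_def cinner_scaleC_left sum_distrib_left)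
  show "Re (cinner x y) = inner x y"
    by (simp add: cinner_vec_def inner_vec_def Re_cinner)
qed

end

instance vec :: (chilbert_space, finite) chilbert_space ..

definition bounded_clinear :: "('a::complex_inner \<Rightarrow> 'b::complex_inner) \<Rightarrow> bool"
  where "bounded_clinear f \<longleftrightarrow> bounded_linear f \<and> (\<forall>c x. f (c *\<^sub>C x) = c *\<^sub>C f x)"

definition contraction :: "('a::complex_inner \<Rightarrow> 'a) \<Rightarrow> bool"
  where "contraction T \<longleftrightarrow> bounded_clinear T \<and> onorm T \<le> 1"

section \<open>Varopoulos operators of type II and order 2\<close>

text \<open>The action of the block matrix with rows \<open>(0, X, 0)\<close>, \<open>(0, 0, X)\<close>, \<open>(0, 0, 0)\<close>.\<close>

definition varopoulosII :: "('a::complex_inner \<Rightarrow> 'a) \<Rightarrow> 'a ^ 3 \<Rightarrow> 'a ^ 3"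
  where "varopoulosII X x = vector [X (x $ 2), X (x $ 3), 0]"

section \<open>Matrix-valued polynomials in two variables\<close>

text \<open>A matrix-valued polynomial is the finitely supported family of its coefficients, the
  key \<open>(p, q)\<close> standing for the monomial \<open>z\<^sub>1\<^sup>p z\<^sub>2\<^sup>q\<close>.\<close>

type_synonym 'l matpoly2 = "(nat \<times> nat) \<Rightarrow>\<^sub>0 complex ^ 'l ^ 'l"

definition matpoly_eval :: "'l::finite matpoly2 \<Rightarrow> complex \<Rightarrow> complex \<Rightarrow> complex ^ 'l ^ 'l"
  where "matpoly_eval P z1 z2 =
    (\<Sum>(p, q)\<in>Poly_Mapping.keys P. (z1 ^ p * z2 ^ q) *\<^sub>C Poly_Mapping.lookup P (p, q))"

text \<open>\<open>mat_tensor A S\<close> is \<open>A \<otimes> S\<close> acting on \<open>\<complex>\<^sup>l \<otimes> 'a\<close>, written as \<open>'a ^ 'l\<close>.\<close>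

definition mat_tensor ::
    "complex ^ 'l ^ 'l \<Rightarrow> ('a::complex_inner \<Rightarrow> 'a) \<Rightarrow> 'a ^ 'l \<Rightarrow> 'a ^ 'l::finite"
  where "mat_tensor A S v = (\<chi> i. \<Sum>j\<in>UNIV. (A $ i $ j) *\<^sub>C S (v $ j))"

definition matpoly_op ::
    "'l::finite matpoly2 \<Rightarrow> ('a::complex_inner \<Rightarrow> 'a) \<Rightarrow> ('a \<Rightarrow> 'a) \<Rightarrow> 'a ^ 'l \<Rightarrow> 'a ^ 'l"
  where "matpoly_op P T1 T2 v =
    (\<Sum>(p, q)\<in>Poly_Mapping.keys P.
        mat_tensor (Poly_Mapping.lookup P (p, q)) ((T1 ^^ p) \<circ> (T2 ^^ q)) v)"

definition matpoly_bidisc_norm :: "'l::finite matpoly2 \<Rightarrow> real"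
  where "matpoly_bidisc_norm P =
    (SUP (z1, z2) \<in> ball 0 1 \<times> ball 0 1. onorm (\<lambda>v. matpoly_eval P z1 z2 *v v))"

text \<open>The supremum and the operator norm take values in the reals and are meaningful only for
  bounded sets and bounded operators; the following facts show that this is the case.\<close>

lemma bdd_above_matpoly_bidisc:
  fixes P :: "'l::finite matpoly2"
  shows "bdd_above ((\<lambda>(z1, z2). onorm (\<lambda>v. matpoly_eval P z1 z2 *v v)) ` (ball 0 1 \<times> ball 0 1))"
proof -
  define B where "B = (\<Sum>i\<in>(UNIV::'l set). \<Sum>j\<in>(UNIV::'l set).
      \<Sum>(p, q)\<in>Poly_Mapping.keys P. cmod (Poly_Mapping.lookup P (p, q) $ i $ j))"
  have "onorm (\<lambda>v. matpoly_eval P z1 z2 *v v) \<le> B" if z: "cmod z1 < 1" "cmod z2 < 1" for z1 z2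
  proof (rule onorm_le)
    fix v :: "complex ^ 'l"
    have entry: "cmod (matpoly_eval P z1 z2 $ i $ j)
        \<le> (\<Sum>(p, q)\<in>Poly_Mapping.keys P. cmod (Poly_Mapping.lookup P (p, q) $ i $ j))" for i j
    proof -
      have "matpoly_eval P z1 z2 $ i $ j
          = (\<Sum>(p, q)\<in>Poly_Mapping.keys P. (z1 ^ p * z2 ^ q) * Poly_Mapping.lookup P (p, q) $ i $ j)"
        by (simp add: matpoly_eval_def scaleC_vec_def scaleC_complex_def case_prod_beta)
      also have "cmod \<dots> \<le> (\<Sum>(p, q)\<in>Poly_Mapping.keys P.
          cmod (Poly_Mapping.lookup P (p, q) $ i $ j))"
        unfolding case_prod_beta
      proof (rule sum_norm_le)
        fix k
        have "cmod (z1 ^ fst k * z2 ^ snd k) \<le> 1"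
          using z by (simp add: norm_mult norm_power mult_le_one power_le_one)
        then show "cmod (z1 ^ fst k * z2 ^ snd k * Poly_Mapping.lookup P (fst k, snd k) $ i $ j)
            \<le> cmod (Poly_Mapping.lookup P (fst k, snd k) $ i $ j)"
          by (subst norm_mult) (rule mult_left_le_one_le, auto)
      qed
      finally show ?thesis .
    qed
    have "norm (matpoly_eval P z1 z2 *v v) \<le> (\<Sum>i\<in>UNIV. norm ((matpoly_eval P z1 z2 *v v) $ i))"
      by (simp add: norm_vec_def L2_set_le_sum)
    also have "\<dots> \<le> (\<Sum>i\<in>UNIV. \<Sum>j\<in>UNIV. cmod (matpoly_eval P z1 z2 $ i $ j) * norm v)"
      unfolding matrix_vector_mult_def
      by (auto intro!: sum_mono sum_norm_le simp: norm_mult mult_left_mono Finite_Cartesian_Product.norm_nth_le)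
    also have "\<dots> \<le> (\<Sum>i\<in>UNIV. \<Sum>j\<in>UNIV.
        (\<Sum>(p, q)\<in>Poly_Mapping.keys P. cmod (Poly_Mapping.lookup P (p, q) $ i $ j)) * norm v)"
      by (intro sum_mono mult_right_mono entry norm_ge_zero)
    also have "\<dots> = B * norm v"
      by (simp add: B_def sum_distrib_right)
    finally show "norm (matpoly_eval P z1 z2 *v v) \<le> B * norm v" .
  qed
  then show ?thesis
    by (intro bdd_aboveI[where M = B]) auto
qed

lemma bounded_linear_scaleC:
  fixes c :: complex
  shows "bounded_linear (\<lambda>x::'a::complex_inner. c *\<^sub>C x)"
proof (rule bounded_linear_intro[where K = "cmod c"])
  fix x y :: 'a and r :: real
  show "c *\<^sub>C (x + y) = c *\<^sub>C x + c *\<^sub>C y"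
    by (rule scaleC_add_right)
  show "c *\<^sub>C (r *\<^sub>R x) = r *\<^sub>R (c *\<^sub>C x)"
    by (simp add: scaleC_of_real[symmetric] scaleC_scaleC mult.commute)
  have "cinner (c *\<^sub>C x) (c *\<^sub>C x) = c * (cnj c * cinner x x)"
    by (metis cinner_commute cinner_scaleC_left complex_cnj_mult)
  also have "\<dots> = complex_of_real ((cmod c)\<^sup>2) * cinner x x"
    by (metis complex_norm_square mult.assoc)
  finally have "Re (cinner (c *\<^sub>C x) (c *\<^sub>C x)) = (cmod c)\<^sup>2 * Re (cinner x x)"
    by (simp only: Re_complex_of_real Im_complex_of_real times_complex.sel)
  then show "norm (c *\<^sub>C x) \<le> norm x * cmod c"
    by (simp add: norm_eq_sqrt_cinner[where 'a = 'a] real_sqrt_mult mult.commute)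
qed

lemma bounded_linear_matpoly_op:
  assumes "bounded_linear T1" "bounded_linear T2"
  shows "bounded_linear (matpoly_op P T1 T2)"
proof -
  have pow: "bounded_linear (T ^^ n)" if "bounded_linear T" for T :: "'a \<Rightarrow> 'a" and n
  proof (induction n)
    case 0
    then show ?case by (simp add: id_def bounded_linear_ident)
  next
    case (Suc n)
    then show ?case
      using bounded_linear_compose[OF that] by (simp add: o_def)
  qed
  have tens: "bounded_linear (mat_tensor A S)"
    if S: "bounded_linear S" for A :: "complex ^ 'b ^ 'b" and S :: "'a \<Rightarrow> 'a"
  proof -
    have "bounded_linear (\<lambda>v. (A $ i $ j) *\<^sub>C S (v $ j))" for i j
      by (rule bounded_linear_compose[OF bounded_linear_scaleC
            bounded_linear_compose[OF S bounded_linear_vec_nth]])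
    then have *: "bounded_linear (\<lambda>v. mat_tensor A S v $ i)" for i
      by (auto simp: mat_tensor_def intro!: bounded_linear_sum)
    show ?thesis
    proof (rule bounded_linear_intro[where K = "\<Sum>i\<in>UNIV. onorm (\<lambda>v. mat_tensor A S v $ i)"])
      show "mat_tensor A S (x + y) = mat_tensor A S x + mat_tensor A S y" for x y
        by (simp add: vec_eq_iff linear_add[OF bounded_linear.linear[OF *]])
      show "mat_tensor A S (r *\<^sub>R x) = r *\<^sub>R mat_tensor A S x" for r x
        by (simp add: vec_eq_iff linear_scale[OF bounded_linear.linear[OF *]])
      fix x
      have "norm (mat_tensor A S x) \<le> (\<Sum>i\<in>UNIV. norm (mat_tensor A S x $ i))"
        by (simp add: norm_vec_def L2_set_le_sum)
      also have "\<dots> \<le> (\<Sum>i\<in>UNIV. onorm (\<lambda>v. mat_tensor A S v $ i) * norm x)"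
        by (intro sum_mono onorm[OF *])
      finally show "norm (mat_tensor A S x) \<le> norm x * (\<Sum>i\<in>UNIV. onorm (\<lambda>v. mat_tensor A S v $ i))"
        by (simp add: sum_distrib_left mult.commute)
    qed
  qed
  have "bounded_linear (\<lambda>v. \<Sum>k\<in>Poly_Mapping.keys P.
      mat_tensor (Poly_Mapping.lookup P (fst k, snd k)) ((T1 ^^ fst k) \<circ> (T2 ^^ snd k)) v)"
    by (intro bounded_linear_sum tens)
      (simp add: o_def bounded_linear_compose[OF pow[OF assms(1)] pow[OF assms(2)]])
  then show ?thesis
    by (simp add: matpoly_op_def[abs_def] case_prod_beta)
qed

end

theory Submission
  imports Defs
begin

text \<open>A Varopoulos operator is \<open>X\<close> tensored with the nilpotent shift of order three. Hence
  \<open>T\<^sub>X\<close> and \<open>T\<^sub>Y\<close> are commuting contractions exactly if \<open>X\<close> and \<open>Y\<close> are, and in \<open>P(T\<^sub>X, T\<^sub>Y)\<close> only the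
  operators \<open>X\<^sup>m Y\<^sup>n\<close> with \<open>m + n \<le> 2\<close> occur. The inequality is an instance of Ando's theorem; because of
  the low degree, a proof is possible that stays within finite powers of \<open>H\<close>.

  Suppose first that \<open>X\<close> is unitary. Conjugation with the diagonal operator \<open>(1, X, X\<^sup>2)\<close> then turns
  \<open>T\<^sub>X\<close> into the scalar shift and \<open>T\<^sub>Y\<close> into the Varopoulos operator of the contraction
  \<open>C = X\<^sup>-\<^sup>1 Y\<close>, so that \<open>P(T\<^sub>X, T\<^sub>Y)\<close> is a function of one contraction and of the shift. It is dealt
  with by a positive kernel: the Fejer kernel of \<open>C\<close> at a point \<open>\<omega>\<close> of the unit circle is a semi-inner
  product (\<open>psd_form_fejer_form\<close>), its Fourier coefficients are the damped powers of \<open>C\<close>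
  (\<open>sum_fejer_form\<close>), and the coefficient matrices may be evaluated inside the average, at the scalar
  point \<open>(z, z \<omega>)\<close> of the torus, the shift being a compression of multiplication by \<open>z\<close> on the
  circle. Since a scalar matrix has the same norm after amplification by any semi-inner product
  (\<open>matrix_amplification\<close>), each value in the average is bounded by the bidisc norm of \<open>P\<close>.
  The damping disappears in the limit.

  In general \<open>X\<close> is replaced by its unitary dilation \<open>U\<close>, and \<open>C\<close> by \<open>U\<^sup>-\<^sup>1\<close> times a contractive lifting of
  \<open>Y\<close> that commutes with \<open>U\<close>. For degree two it suffices to know \<open>C\<close> between the subspaces \<open>H\<close>,
  \<open>U H\<close> and \<open>U\<^sup>2 H\<close>, which all lie in the first two steps of the dilation; this part of the commutant
  lifting theorem is \<open>commutant_lifting_on_finite_set\<close>. To prove a norm inequality at a given vector it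
  is enough that the lifting be correct at finitely many vectors, so that orthogonal projections reduce
  to finite least squares problems (\<open>least_squares\<close>).\<close>

section \<open>Complex-linear maps and positive semidefinite forms\<close>

definition complex_linear :: "('a::complex_inner \<Rightarrow> 'b::complex_inner) \<Rightarrow> bool"
  where "complex_linear f \<longleftrightarrow> (\<forall>x y. f (x + y) = f x + f y) \<and> (\<forall>c x. f (c *\<^sub>C x) = c *\<^sub>C f x)"

lemma scaleC_minus_one: "(-1) *\<^sub>C x = - (x::'a::complex_inner)"
  using scaleC_of_real[of "-1" x] by simp

lemma scaleC_one [simp]: "1 *\<^sub>C x = (x::'a::complex_inner)"
  using scaleC_of_real[of "1" x] by simp

lemma scaleC_zero_right [simp]: "c *\<^sub>C (0::'a::complex_inner) = 0"
  using scaleC_add_right[of c 0 "0::'a"] by simp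

lemma scaleC_sum_right: "c *\<^sub>C (\<Sum>i\<in>I. f i) = (\<Sum>i\<in>I. c *\<^sub>C (f i :: 'a::complex_inner))"
  by (induction I rule: infinite_finite_induct) (simp_all add: scaleC_add_right)

context
  fixes f :: "'a::complex_inner \<Rightarrow> 'b::complex_inner"
  assumes f: "complex_linear f"
begin

lemma complex_linear_add: "f (x + y) = f x + f y"
  using f by (simp add: complex_linear_def)

lemma complex_linear_scaleC: "f (c *\<^sub>C x) = c *\<^sub>C f x"
  using f by (simp add: complex_linear_def)

lemma complex_linear_0: "f 0 = 0"
  using complex_linear_add[of 0 0] by simp

lemma complex_linear_diff: "f (x - y) = f x - f y"
proof -
  have "f (x + (-1) *\<^sub>C y) = f x + (-1) *\<^sub>C f y"
    by (simp only: complex_linear_add complex_linear_scaleC)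
  then show ?thesis by (simp add: scaleC_minus_one)
qed

lemma complex_linear_sum: "f (\<Sum>i\<in>I. g i) = (\<Sum>i\<in>I. f (g i))"
  by (induction I rule: infinite_finite_induct) (simp_all add: complex_linear_0 complex_linear_add)

end

lemma complex_linear_compose:
  assumes "complex_linear f" "complex_linear g"
  shows "complex_linear (\<lambda>x. f (g x))"
  using assms by (simp add: complex_linear_def)

lemma complex_linear_funpow:
  fixes f :: "'a::complex_inner \<Rightarrow> 'a"
  assumes "complex_linear f"
  shows "complex_linear (f ^^ n)"
  using assms by (induction n) (auto simp: complex_linear_def)

text \<open>A semi-inner product, linear in the first argument. Vectors of length zero are not divided
  out: in this way the defect form \<open>\<langle>x, y\<rangle> - \<langle>X x, X y\<rangle>\<close> of a
  contraction can stand in for the inner product of its defect space, without a square root of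
  \<open>1 - X\<^sup>* X\<close>.\<close>

locale psd_form =
  fixes q :: "'k::complex_inner \<Rightarrow> 'k \<Rightarrow> complex"
  assumes add_left: "q (x + y) z = q x z + q y z"
    and scale_left: "q (c *\<^sub>C x) z = c * q x z"
    and hermitian: "q x y = cnj (q y x)"
    and nonneg: "0 \<le> Re (q x x)"
begin

lemma add_right: "q z (x + y) = q z x + q z y"
  using hermitian[of z] hermitian[of _ z] add_left by (metis complex_cnj_add)

lemma scale_right: "q z (c *\<^sub>C x) = cnj c * q z x"
  using hermitian[of z] hermitian[of _ z] scale_left by (metis complex_cnj_mult)

lemma zero_left [simp]: "q 0 x = 0"
  using scale_left[of 0 0 x] by simp

lemma zero_right [simp]: "q x 0 = 0"
  using scale_right[of x 0 0] by simp

lemma diff_left: "q (x - y) z = q x z - q y z"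
  using add_left[of x "(-1) *\<^sub>C y" z] scale_left[of "-1" y z] by (simp add: scaleC_minus_one)

lemma diff_right: "q z (x - y) = q z x - q z y"
  using add_right[of z x "(-1) *\<^sub>C y"] scale_right[of z "-1" y] by (simp add: scaleC_minus_one)

lemma sum_left: "q (\<Sum>i\<in>I. f i) z = (\<Sum>i\<in>I. q (f i) z)"
  by (induction I rule: infinite_finite_induct) (simp_all add: add_left)

lemma sum_right: "q z (\<Sum>i\<in>I. f i) = (\<Sum>i\<in>I. q z (f i))"
  by (induction I rule: infinite_finite_induct) (simp_all add: add_right)

lemma diagonal_real: "q x x = of_real (Re (q x x))"
  using hermitian[of x x] by (simp add: complex_eq_iff)

text \<open>Positivity at \<open>x - t q(x, y) y\<close> gives a quadratic inequality in the real number \<open>t\<close>. It is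
  used at its minimum \<open>t = 1 / q(y, y)\<close>, or for large \<open>t\<close> when \<open>y\<close> is a null vector.\<close>

lemma Cauchy_Schwarz: "(cmod (q x y))\<^sup>2 \<le> Re (q x x) * Re (q y y)"
proof -
  define m where "m = (cmod (q x y))\<^sup>2"
  have quad: "0 \<le> Re (q x x) - 2 * t * m + t\<^sup>2 * m * Re (q y y)" for t :: real
  proof -
    define c where "c = of_real t * q x y"
    have "q (x - c *\<^sub>C y) (x - c *\<^sub>C y) = q x x - cnj c * q x y - c * cnj (q x y) + c * cnj c * q y y"
      using hermitian[of y x]
      by (simp add: diff_left diff_right scale_left scale_right algebra_simps)
    also have "\<dots> = of_real (Re (q x x) - 2 * t * m + t\<^sup>2 * m * Re (q y y))"
      using diagonal_real[of x] diagonal_real[of y] complex_norm_square[of "q x y"]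
      by (simp add: c_def m_def algebra_simps power2_eq_square)
    finally show ?thesis using nonneg[of "x - c *\<^sub>C y"] by simp
  qed
  show ?thesis
  proof (cases "Re (q y y) = 0")
    case True
    have "m \<ge> 0" by (simp add: m_def)
    have "m = 0"
    proof (rule ccontr)
      assume "m \<noteq> 0"
      with quad[of "(Re (q x x) + 1) / (2 * m)"] True show False by simp
    qed
    then show ?thesis using True by (simp add: m_def)
  next
    case False
    then have "Re (q y y) > 0" using nonneg[of y] by simp
    moreover have "(1 / Re (q y y))\<^sup>2 * m * Re (q y y) = m / Re (q y y)"
      using False by (simp add: power2_eq_square)
    with quad[of "1 / Re (q y y)"] have "m / Re (q y y) \<le> Re (q x x)" by simp
    ultimately have "m \<le> Re (q x x) * Re (q y y)" by (simp only: pos_divide_le_eq)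
    then show ?thesis by (simp only: m_def)
  qed
qed

lemma null_right: "Re (q y y) = 0 \<Longrightarrow> q x y = 0"
  using Cauchy_Schwarz[of x y] by simp

lemma null_left: "Re (q x x) = 0 \<Longrightarrow> q x y = 0"
  using Cauchy_Schwarz[of x y] by simp

text \<open>The pullback of \<open>q\<close> along the projection onto the complement of \<open>s\<close>; this is one step of a
  Cholesky factorization. For a null vector \<open>s\<close> the quotient is \<open>0 / 0 = 0\<close> and nothing is
  subtracted.\<close>

lemma project_away:
  "psd_form (\<lambda>x y. q x y - q x s * q s y / q s s)"
proof
  fix x y z c
  show "q (x + y) z - q (x + y) s * q s z / q s s =
      (q x z - q x s * q s z / q s s) + (q y z - q y s * q s z / q s s)"
    by (simp add: add_left add_divide_distrib distrib_right)
  show "q (c *\<^sub>C x) z - q (c *\<^sub>C x) s * q s z / q s s = c * (q x z - q x s * q s z / q s s)"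
    by (simp add: scale_left right_diff_distrib)
  show "q x y - q x s * q s y / q s s = cnj (q y x - q y s * q s x / q s s)"
    using hermitian[of x y] hermitian[of x s] hermitian[of s y] hermitian[of s s] by simp
  have "q x s * q s x / q s s = of_real ((cmod (q x s))\<^sup>2 / Re (q s s))"
    using hermitian[of s x] complex_norm_square[of "q x s"] diagonal_real[of s] by simp
  then have "Re (q x x - q x s * q s x / q s s) = Re (q x x) - (cmod (q x s))\<^sup>2 / Re (q s s)"
    by simp
  also have "\<dots> \<ge> 0"
    using Cauchy_Schwarz[of x s] nonneg[of s] nonneg[of x]
    by (cases "Re (q s s) = 0") (simp_all add: field_simps)
  finally show "0 \<le> Re (q x x - q x s * q s x / q s s)" .
qed

end

text \<open>Finitely many vectors of a semi-inner product space have coordinates in some \<open>\<complex>\<^sup>n\<close>. The vectors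
  are eliminated one at a time: after projecting \<open>s\<close> away, the remaining form has fewer vectors to
  take care of, and the part removed is the rank one form carried by one further coordinate.\<close>

lemma gram_factorization:
  assumes "finite S" "psd_form q"
  shows "\<exists>(n::nat) c. \<forall>x\<in>S. \<forall>y\<in>S. q x y = (\<Sum>k<n. c x k * cnj (c y k))"
  using assms
proof (induction S arbitrary: q rule: finite_induct)
  case empty
  then show ?case by simp
next
  case (insert s S)
  interpret psd_form q by fact
  define q' where "q' x y = q x y - q x s * q s y / q s s" for x y
  have "psd_form q'"
    using project_away[of s] by (simp add: q'_def[abs_def])
  from insert.IH[OF this] obtain n and c :: "'a \<Rightarrow> nat \<Rightarrow> complex" where
    c: "\<And>x y. x \<in> S \<Longrightarrow> y \<in> S \<Longrightarrow> q' x y = (\<Sum>k<n. c x k * cnj (c y k))" by blast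
  define c' where "c' x k = (if k = n then q x s / of_real (sqrt (Re (q s s))) else if x = s then 0 else c x k)"
    for x k
  have sq: "of_real (sqrt (Re (q s s))) * of_real (sqrt (Re (q s s))) = q s s"
    using nonneg[of s] diagonal_real[of s] by (simp flip: of_real_mult)
  have top: "c' x n * cnj (c' y n) = q x s * q s y / q s s" for x y
    using hermitian[of s y] sq by (simp add: c'_def flip: times_divide_times_eq)
  \<comment> \<open>\<open>s\<close> is null for \<open>q'\<close>, which allows its old coordinates to be reset to zero.\<close>
  have s0: "q' x s = 0" "q' s x = 0" for x
  proof -
    have "q x s = 0" "q s x = 0" if "q s s = 0"
      using that by (auto intro: null_right null_left)
    then show "q' x s = 0" "q' s x = 0"
      by (cases "q s s = 0"; simp add: q'_def)+
  qed
  have "q x y = (\<Sum>k<Suc n. c' x k * cnj (c' y k))" if "x \<in> insert s S" "y \<in> insert s S" for x y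
  proof -
    have "q' x y = (\<Sum>k<n. c' x k * cnj (c' y k))"
    proof (cases "x = s \<or> y = s")
      case True
      then have "(\<Sum>k<n. c' x k * cnj (c' y k)) = 0"
        by (intro sum.neutral) (auto simp: c'_def)
      then show ?thesis using True s0 by auto
    next
      case False
      then show ?thesis using c[of x y] that by (simp add: c'_def)
    qed
    then show ?thesis by (simp add: top q'_def algebra_simps)
  qed
  then show ?case by blast
qed

text \<open>A matrix \<open>A\<close> with \<open>\<parallel>A\<parallel> \<le> c\<close> still has norm at most \<open>c\<close> as the operator \<open>A \<otimes> 1\<close> on columns of
  vectors, whatever the semi-inner product \<open>q\<close> is: in coordinates \<open>A \<otimes> 1\<close> is a direct sum of copies
  of \<open>A\<close>. The arithmetic mean of the two squared norms replaces their product because it is additive,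
  so that it can be averaged over the torus below.\<close>

lemma (in psd_form) matrix_amplification:
  fixes A :: "complex ^ 'l ^ 'l::finite" and x y :: "'l \<Rightarrow> 'k"
  assumes A: "\<And>u. norm (A *v u) \<le> c * norm u" and c: "0 \<le> c"
  shows "Re (\<Sum>i\<in>UNIV. \<Sum>j\<in>UNIV. A $ i $ j * q (x j) (y i))
    \<le> c / 2 * ((\<Sum>j\<in>UNIV. Re (q (x j) (x j))) + (\<Sum>i\<in>UNIV. Re (q (y i) (y i))))"
proof -
  have "finite (range x \<union> range y)" by simp
  from gram_factorization[OF this psd_form_axioms] obtain n and g :: "'k \<Rightarrow> nat \<Rightarrow> complex"
    where g: "\<And>a b. a \<in> range x \<union> range y \<Longrightarrow> b \<in> range x \<union> range y \<Longrightarrow>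
      q a b = (\<Sum>k<n. g a k * cnj (g b k))" by blast
  define u where "u k = (\<chi> j. g (x j) k)" for k
  define w where "w k = (\<chi> i. g (y i) k)" for k
  have diag: "(\<Sum>j\<in>UNIV. Re (q (z j) (z j))) = (\<Sum>k<n. (norm (\<chi> j. g (z j) k))\<^sup>2)"
    if "range z \<subseteq> range x \<union> range y" for z :: "'l \<Rightarrow> 'k"
  proof -
    have "Re (q (z j) (z j)) = (\<Sum>k<n. (cmod (g (z j) k))\<^sup>2)" for j
    proof -
      have "z j \<in> range x \<union> range y" using that by blast
      from g[OF this this] show ?thesis
        by (simp add: cmod_power2 power2_eq_square[of "Re _"] power2_eq_square[of "Im _"])
    qed
    then show ?thesis
      by (simp add: norm_vec_def L2_set_def real_sqrt_pow2 sum_nonneg) (rule sum.swap)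
  qed
  have "(\<Sum>i\<in>UNIV. \<Sum>j\<in>UNIV. A $ i $ j * q (x j) (y i))
      = (\<Sum>i\<in>UNIV. \<Sum>j\<in>UNIV. \<Sum>k<n. A $ i $ j * (g (x j) k * cnj (g (y i) k)))"
    by (simp add: g sum_distrib_left)
  also have "\<dots> = (\<Sum>i\<in>UNIV. \<Sum>k<n. \<Sum>j\<in>UNIV. A $ i $ j * (g (x j) k * cnj (g (y i) k)))"
    by (intro sum.cong refl sum.swap)
  also have "\<dots> = (\<Sum>k<n. \<Sum>i\<in>UNIV. \<Sum>j\<in>UNIV. A $ i $ j * (g (x j) k * cnj (g (y i) k)))"
    by (rule sum.swap)
  also have "\<dots> = (\<Sum>k<n. cinner (A *v u k) (w k))"
    by (simp add: cinner_vec_def cinner_complex_def matrix_vector_mult_def u_def w_def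
        sum_distrib_right mult.assoc)
  finally have "Re (\<Sum>i\<in>UNIV. \<Sum>j\<in>UNIV. A $ i $ j * q (x j) (y i)) = (\<Sum>k<n. inner (A *v u k) (w k))"
    by (simp add: Re_cinner)
  also have "\<dots> \<le> (\<Sum>k<n. c / 2 * ((norm (u k))\<^sup>2 + (norm (w k))\<^sup>2))"
  proof (rule sum_mono)
    fix k
    have "inner (A *v u k) (w k) \<le> norm (A *v u k) * norm (w k)"
      by (rule norm_cauchy_schwarz)
    also have "\<dots> \<le> c * (norm (u k) * norm (w k))"
      using mult_right_mono[OF A[of "u k"], of "norm (w k)"] by (simp add: mult.assoc)
    also have "\<dots> \<le> c * (((norm (u k))\<^sup>2 + (norm (w k))\<^sup>2) / 2)"
      using sum_squares_bound[of "norm (u k)" "norm (w k)"]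
      by (intro mult_left_mono c) (simp add: power2_eq_square)
    finally show "inner (A *v u k) (w k) \<le> c / 2 * ((norm (u k))\<^sup>2 + (norm (w k))\<^sup>2)" by simp
  qed
  also have "\<dots> = c / 2 * ((\<Sum>j\<in>UNIV. Re (q (x j) (x j))) + (\<Sum>i\<in>UNIV. Re (q (y i) (y i))))"
    by (simp add: diag u_def w_def sum_distrib_left sum.distrib distrib_left)
  finally show ?thesis .
qed

text \<open>\<open>\<pi> x\<close> solves the least squares problem for \<open>x\<close> and the image under \<open>J\<close> of the span of \<open>S\<close>.
  Thus \<open>\<pi>\<close> plays the part of the adjoint of an isometry \<open>J\<close>, as far as finitely many vectors are
  concerned. Gram-Schmidt orthogonalization gives \<open>\<pi>\<close> and its linearity at once. The last conclusion
  expresses that \<open>x - J (\<pi> x)\<close> is orthogonal to the whole image, without mentioning spans.\<close>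

lemma (in psd_form) least_squares:
  fixes J :: "'u::complex_inner \<Rightarrow> 'k"
  assumes "finite S" and J: "complex_linear J"
  shows "\<exists>\<pi>. complex_linear \<pi> \<and> (\<forall>x. \<forall>s\<in>S. q (x - J (\<pi> x)) (J s) = 0)
    \<and> (\<forall>x y. q (x - J (\<pi> x)) (J (\<pi> y)) = 0)"
  using \<open>finite S\<close>
proof (induction S rule: finite_induct)
  case empty
  have "complex_linear (\<lambda>x::'k. 0::'u)" by (simp add: complex_linear_def)
  then show ?case using complex_linear_0[OF J] by (intro exI[of _ "\<lambda>x. 0"]) simp
next
  case (insert s S)
  then obtain \<pi> where \<pi>: "complex_linear \<pi>"
    and orth: "\<And>x t. t \<in> S \<Longrightarrow> q (x - J (\<pi> x)) (J t) = 0"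
      "\<And>x y. q (x - J (\<pi> x)) (J (\<pi> y)) = 0" by blast
  define e where "e = s - \<pi> (J s)"
  have Je: "J e = J s - J (\<pi> (J s))" by (simp add: e_def complex_linear_diff[OF J])
  define \<pi>' where "\<pi>' x = \<pi> x + (q x (J e) / q (J e) (J e)) *\<^sub>C e" for x
  have lin: "complex_linear \<pi>'"
    using \<pi> by (simp add: complex_linear_def \<pi>'_def add_left scale_left add_divide_distrib
        scaleC_add_left scaleC_add_right scaleC_scaleC algebra_simps)
  have res: "x - J (\<pi>' x) = (x - J (\<pi> x)) - (q x (J e) / q (J e) (J e)) *\<^sub>C J e" for x
    by (simp add: \<pi>'_def complex_linear_add[OF J] complex_linear_scaleC[OF J])
  have o1: "q (x - J (\<pi>' x)) (J t) = 0" if "t \<in> S" for x t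
    using orth(1)[OF that, of x] orth(1)[OF that, of "J s"]
    by (simp add: res diff_left[of _ "_ *\<^sub>C _"] scale_left flip: Je)
  have o2: "q (x - J (\<pi>' x)) (J (\<pi> y)) = 0" for x y
    using orth(2)[of x y] orth(2)[of "J s" y]
    by (simp add: res diff_left[of _ "_ *\<^sub>C _"] scale_left flip: Je)
  have o3: "q (x - J (\<pi>' x)) (J e) = 0" for x
  proof -
    have "q (J e) (J (\<pi> x)) = 0" using orth(2)[of "J s" x] by (simp add: Je)
    then have "q (J (\<pi> x)) (J e) = 0" using hermitian[of "J (\<pi> x)" "J e"] by simp
    moreover have "q (J e) (J e) = 0 \<Longrightarrow> q x (J e) = 0" using null_right[of "J e" x] by simp
    ultimately show ?thesis by (cases "q (J e) (J e) = 0") (simp_all add: res diff_left scale_left)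
  qed
  have "J s = J e + J (\<pi> (J s))" by (simp add: Je)
  then have o4: "q (x - J (\<pi>' x)) (J s) = 0" for x
    using o2[of x "J s"] o3[of x] by (metis add_right add.right_neutral)
  have o5: "q (x - J (\<pi>' x)) (J (\<pi>' y)) = 0" for x y
    using o2[of x y] o3[of x]
    by (simp add: \<pi>'_def[of y] complex_linear_add[OF J] complex_linear_scaleC[OF J] add_right scale_right)
  show ?case using lin o1 o4 o5 by (intro exI[of _ \<pi>']) auto
qed

section \<open>The Fejer kernel of a contraction\<close>

definition geometric_sum :: "('k::complex_inner \<Rightarrow> 'k) \<Rightarrow> complex \<Rightarrow> nat \<Rightarrow> 'k \<Rightarrow> 'k"
  where "geometric_sum C \<omega> n a = (\<Sum>i<n. (cnj \<omega>) ^ i *\<^sub>C (C ^^ i) a)"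

lemma geometric_sum_Suc:
  assumes C: "complex_linear C"
  shows "geometric_sum C \<omega> (Suc n) a = a + cnj \<omega> *\<^sub>C C (geometric_sum C \<omega> n a)"
  unfolding geometric_sum_def
  by (subst sum.lessThan_Suc_shift)
    (simp add: complex_linear_sum[OF C] complex_linear_scaleC[OF C] scaleC_sum_right scaleC_scaleC)

lemma complex_linear_geometric_sum:
  assumes "complex_linear C"
  shows "complex_linear (geometric_sum C \<omega> n)"
  using complex_linear_funpow[OF assms]
  by (simp add: complex_linear_def geometric_sum_def scaleC_add_right sum.distrib scaleC_sum_right
      scaleC_scaleC mult.commute)

text \<open>In terms of a Hilbert space, this is the form of the operator
  \<open>\<Sum>k. (1 - \<bar>k\<bar> / N) cnj \<omega> ^ k C\<^sup>(\<^sup>k\<^sup>)\<close>, the sum ranging over \<open>\<bar>k\<bar> < N\<close>, where \<open>C\<^sup>(\<^sup>k\<^sup>)\<close> is \<open>C\<^sup>k\<close> for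
  \<open>k \<ge> 0\<close> and the adjoint of \<open>C\<^sup>-\<^sup>k\<close> for \<open>k < 0\<close>. Written as a mean of partial sums, it needs no adjoint.\<close>

definition fejer_form ::
  "('k::complex_inner \<Rightarrow> 'k \<Rightarrow> complex) \<Rightarrow> ('k \<Rightarrow> 'k) \<Rightarrow> nat \<Rightarrow> complex \<Rightarrow> 'k \<Rightarrow> 'k \<Rightarrow> complex"
  where "fejer_form q C N \<omega> a b =
    (\<Sum>n<N. q (geometric_sum C \<omega> (Suc n) a) b + q a (geometric_sum C \<omega> (Suc n) b) - q a b) / of_nat N"

text \<open>Let \<open>s n\<close> be the geometric sums applied to \<open>x\<close>. Since \<open>s (n + 1) - x\<close> is \<open>C (s n)\<close> up to a
  factor of modulus one, polarization and contractivity show that the \<open>n\<close>-th summand of the kernel is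
  at least \<open>\<parallel>s (n + 1)\<parallel>\<^sup>2 - \<parallel>s n\<parallel>\<^sup>2\<close>, and the sum of these differences telescopes to
  \<open>\<parallel>s N\<parallel>\<^sup>2 \<ge> 0\<close>.\<close>

lemma psd_form_fejer_form:
  assumes "psd_form q" and C: "complex_linear C"
    and contractive: "\<And>x. Re (q (C x) (C x)) \<le> Re (q x x)"
    and \<omega>: "cmod \<omega> = 1"
  shows "psd_form (fejer_form q C N \<omega>)"
proof -
  interpret psd_form q by fact
  let ?s = "\<lambda>n. geometric_sum C \<omega> n"
  note lin = complex_linear_geometric_sum[OF C, of \<omega>]
  show ?thesis
  proof
    fix x y z :: 'a and c :: complex
    show "fejer_form q C N \<omega> (x + y) z = fejer_form q C N \<omega> x z + fejer_form q C N \<omega> y z"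
      unfolding fejer_form_def complex_linear_add[OF lin] add_left add_divide_distrib[symmetric]
        sum.distrib[symmetric]
      by (simp add: algebra_simps)
    show "fejer_form q C N \<omega> (c *\<^sub>C x) z = c * fejer_form q C N \<omega> x z"
      unfolding fejer_form_def complex_linear_scaleC[OF lin] scale_left times_divide_eq_right
        sum_distrib_left
      by (simp add: algebra_simps)
    show "fejer_form q C N \<omega> x y = cnj (fejer_form q C N \<omega> y x)"
      unfolding fejer_form_def complex_cnj_divide cnj_sum complex_cnj_diff complex_cnj_add
        hermitian[symmetric] by (simp add: algebra_simps)
    have step: "Re (q (?s (Suc n) x) (?s (Suc n) x)) - Re (q (?s n x) (?s n x))
        \<le> Re (q (?s (Suc n) x) x + q x (?s (Suc n) x) - q x x)" for n
    proof -
      let ?S = "?s (Suc n) x"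
      have "q ?S x + q x ?S - q x x = q ?S ?S - q (?S - x) (?S - x)"
        by (simp add: diff_left diff_right)
      moreover have "?S - x = cnj \<omega> *\<^sub>C C (?s n x)" by (simp add: geometric_sum_Suc[OF C])
      moreover have "\<omega> * cnj \<omega> = 1" using \<omega> complex_norm_square[of \<omega>] by simp
      then have "q (cnj \<omega> *\<^sub>C C (?s n x)) (cnj \<omega> *\<^sub>C C (?s n x)) = q (C (?s n x)) (C (?s n x))"
        unfolding scale_left scale_right by (simp add: mult.commute[of "cnj \<omega>"] flip: mult.assoc)
      ultimately show ?thesis using contractive[of "?s n x"] by simp
    qed
    have "0 \<le> Re (q (?s N x) (?s N x)) - Re (q (?s 0 x) (?s 0 x))"
      by (simp add: nonneg geometric_sum_def[of _ _ 0])
    also have "\<dots> = (\<Sum>n<N. Re (q (?s (Suc n) x) (?s (Suc n) x)) - Re (q (?s n x) (?s n x)))"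
      by (rule sum_lessThan_telescope[symmetric])
    also have "\<dots> \<le> (\<Sum>n<N. Re (q (?s (Suc n) x) x + q x (?s (Suc n) x) - q x x))"
      by (rule sum_mono) (rule step)
    finally show "0 \<le> Re (fejer_form q C N \<omega> x x)"
      unfolding fejer_form_def Re_divide_of_nat Re_sum by (intro divide_nonneg_nonneg) auto
  qed
qed

section \<open>Averages over roots of unity\<close>

definition unit_root :: "nat \<Rightarrow> nat \<Rightarrow> complex"
  where "unit_root M t = cis (2 * pi * real t / real M)"

lemma cmod_unit_root [simp]: "cmod (unit_root M t) = 1"
  by (simp add: unit_root_def)

lemma sum_unit_roots:
  assumes "a < M" "b < M"
  shows "(\<Sum>t<M. unit_root M t ^ a * cnj (unit_root M t) ^ b) = (if a = b then of_nat M else 0)"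
proof -
  define d where "d = 2 * pi * (real a - real b) / real M"
  have M: "M > 0" using assms by simp
  have product: "unit_root M t ^ a * cnj (unit_root M t) ^ b = cis d ^ t" for t
  proof -
    have "real a * (2 * pi * real t / real M) + real b * - (2 * pi * real t / real M) = real t * d"
      by (simp add: d_def algebra_simps diff_divide_distrib)
    then show ?thesis unfolding unit_root_def cis_cnj Complex.DeMoivre cis_mult by (rule arg_cong)
  qed
  show ?thesis
  proof (cases "a = b")
    case True
    then show ?thesis unfolding product by (simp add: d_def)
  next
    case False
    have ne: "cis d \<noteq> 1"
    proof
      assume "cis d = 1"
      then have "cos d = 1" by (simp add: complex_eq_iff)
      then obtain n :: int where "d = of_int n * (2 * pi)" using cos_one_2pi_int by auto
      then have "2 * pi * (real a - real b) = 2 * pi * (of_int n * real M)"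
        using M by (simp add: d_def divide_simps mult_ac)
      then have "real a - real b = of_int n * real M"
        by (simp only: mult_cancel_left) simp
      then have "real_of_int (int a - int b) = real_of_int (n * int M)" by simp
      then have eq: "int a - int b = n * int M" by (simp only: of_int_eq_iff)
      then have "n \<noteq> 0" using False by auto
      then have "int M * 1 \<le> int M * \<bar>n\<bar>" by (intro mult_left_mono) auto
      also have "\<dots> = \<bar>int a - int b\<bar>" using eq by (simp add: abs_mult mult.commute)
      finally show False using assms by linarith
    qed
    have "cis d ^ M = 1"
    proof -
      have "cis d ^ M = cis (2 * pi * of_int (int a - int b))"
        unfolding Complex.DeMoivre d_def by (rule arg_cong[of _ _ cis]) (use M in simp)
      then show ?thesis by (simp only: cis_multiple_2pi Ints_of_int)
    qed
    then show ?thesis unfolding product using ne False by (simp add: sum_gp_strict)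
  qed
qed

text \<open>The Fourier coefficients of the kernel are the powers of \<open>C\<close> damped by the Fejer weights. The
  roots of unity integrate the occurring monomials exactly because their order exceeds all
  exponents.\<close>

lemma sum_fejer_form:
  assumes "psd_form q" and C: "complex_linear C" and p: "p < N" and M: "p + N < M"
  shows "(\<Sum>t<M. unit_root M t ^ p * fejer_form q C N (unit_root M t) a b)
    = of_nat M * of_real (1 - real p / real N) * q ((C ^^ p) a) b"
proof -
  interpret psd_form q by fact
  let ?w = "unit_root M"
  have one: "(\<Sum>t<M. ?w t ^ p * q (geometric_sum C (?w t) (Suc n) a) b)
      = (if p \<le> n then of_nat M * q ((C ^^ p) a) b else 0)" if n: "n < N" for n
  proof -
    have "(\<Sum>t<M. ?w t ^ p * q (geometric_sum C (?w t) (Suc n) a) b)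
        = (\<Sum>i<Suc n. (\<Sum>t<M. ?w t ^ p * cnj (?w t) ^ i) * q ((C ^^ i) a) b)"
      unfolding geometric_sum_def sum_left scale_left sum_distrib_left sum_distrib_right
      by (subst sum.swap) (simp add: mult.assoc)
    also have "\<dots> = (\<Sum>i<Suc n. if p = i then of_nat M * q ((C ^^ p) a) b else 0)"
    proof (rule sum.cong[OF refl])
      fix i assume "i \<in> {..<Suc n}"
      then show "(\<Sum>t<M. ?w t ^ p * cnj (?w t) ^ i) * q ((C ^^ i) a) b
          = (if p = i then of_nat M * q ((C ^^ p) a) b else 0)"
        using n M by (subst sum_unit_roots) auto
    qed
    finally show ?thesis by (simp add: less_Suc_eq_le)
  qed
  have zero: "(\<Sum>t<M. ?w t ^ p * q a b) = (if p = 0 then of_nat M * q a b else 0)"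
    using sum_unit_roots[of p M 0] M by (simp flip: sum_distrib_right)
  have two: "(\<Sum>t<M. ?w t ^ p * q a (geometric_sum C (?w t) (Suc n) b))
      = (if p = 0 then of_nat M * q a b else 0)" if n: "n < N" for n
  proof -
    have "(\<Sum>t<M. ?w t ^ p * q a (geometric_sum C (?w t) (Suc n) b))
        = (\<Sum>i<Suc n. (\<Sum>t<M. ?w t ^ (p + i) * cnj (?w t) ^ 0) * q a ((C ^^ i) b))"
      unfolding geometric_sum_def sum_right scale_right sum_distrib_left sum_distrib_right
      by (subst sum.swap) (simp add: power_add mult.assoc)
    also have "\<dots> = (\<Sum>i<Suc n. if i = 0 then (if p = 0 then of_nat M * q a b else 0) else 0)"
    proof (rule sum.cong[OF refl])
      fix i assume "i \<in> {..<Suc n}"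
      then show "(\<Sum>t<M. ?w t ^ (p + i) * cnj (?w t) ^ 0) * q a ((C ^^ i) b)
          = (if i = 0 then (if p = 0 then of_nat M * q a b else 0) else 0)"
        using n M by (subst sum_unit_roots) auto
    qed
    finally show ?thesis by simp
  qed
  have "(\<Sum>t<M. ?w t ^ p * fejer_form q C N (?w t) a b)
      = (\<Sum>n<N. (\<Sum>t<M. ?w t ^ p * q (geometric_sum C (?w t) (Suc n) a) b)
          + (\<Sum>t<M. ?w t ^ p * q a (geometric_sum C (?w t) (Suc n) b))
          - (\<Sum>t<M. ?w t ^ p * q a b)) / of_nat N"
    unfolding fejer_form_def times_divide_eq_right sum_divide_distrib[symmetric] sum_distrib_left
    by (subst sum.swap) (simp add: sum.distrib sum_subtractf distrib_left right_diff_distrib)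
  also have "\<dots> = (\<Sum>n<N. if p \<le> n then of_nat M * q ((C ^^ p) a) b else 0) / of_nat N"
    by (simp add: one two zero)
  also have "(\<Sum>n<N. if p \<le> n then of_nat M * q ((C ^^ p) a) b else 0)
      = of_nat (N - p) * (of_nat M * q ((C ^^ p) a) b)"
  proof -
    have "{..<N} \<inter> {n. p \<le> n} = {p..<N}" by auto
    then show ?thesis by (simp add: sum.If_cases)
  qed
  finally show ?thesis using p by (simp add: of_nat_diff field_simps)
qed

section \<open>Lifting a commuting pair of contractions\<close>

lemma psd_form_cinner: "psd_form (cinner :: 'a::complex_inner \<Rightarrow> 'a \<Rightarrow> complex)"
  by standard (simp_all add: cinner_add_left cinner_scaleC_left Re_cinner, rule cinner_commute)

lemma psd_form_pullback:
  assumes "psd_form q" and f: "complex_linear f"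
  shows "psd_form (\<lambda>x y. q (f x) (f y))"
proof -
  interpret psd_form q by fact
  show ?thesis
    by standard (simp_all add: complex_linear_add[OF f] complex_linear_scaleC[OF f] add_left
        scale_left nonneg, rule hermitian)
qed

lemma psd_form_plus:
  assumes "psd_form q" "psd_form r"
  shows "psd_form (\<lambda>x y. q x y + r x y)"
proof -
  interpret q: psd_form q by fact
  interpret r: psd_form r by fact
  show ?thesis
  proof
    show "q x y + r x y = cnj (q y x + r y x)" for x y
      using q.hermitian[of x y] r.hermitian[of x y] by simp
  qed (simp_all add: q.add_left r.add_left q.scale_left r.scale_left q.nonneg r.nonneg distrib_left)
qed

definition defect :: "('a::complex_inner \<Rightarrow> 'a) \<Rightarrow> 'a \<Rightarrow> 'a \<Rightarrow> complex"
  where "defect X x y = cinner x y - cinner (X x) (X y)"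

lemma Re_cinner_self: "Re (cinner x x) = (norm x)\<^sup>2"
  by (simp add: Re_cinner power2_norm_eq_inner)

lemma psd_form_defect:
  assumes X: "complex_linear X" and contractive: "\<And>h. norm (X h) \<le> norm h"
  shows "psd_form (defect X)"
proof
  show "defect X x y = cnj (defect X y x)" for x y
    using cinner_commute[of x y] cinner_commute[of "X x" "X y"] by (simp add: defect_def)
  show "0 \<le> Re (defect X x x)" for x
    using contractive[of x] by (simp add: defect_def Re_cinner_self power_mono)
qed (simp_all add: defect_def complex_linear_add[OF X] complex_linear_scaleC[OF X]
    cinner_add_left cinner_scaleC_left right_diff_distrib)

lemma scaleC_vec_nth [simp]: "(c *\<^sub>C x) $ i = c *\<^sub>C (x $ i)"
  by (simp add: scaleC_vec_def)

lemma complex_linear_vec_nth: "complex_linear (\<lambda>x::'a::complex_inner ^ 'n::finite. x $ i)"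
  by (simp add: complex_linear_def)

text \<open>The first steps of the isometric dilation of \<open>X\<close>: the space is \<open>H \<oplus> D \<oplus> D\<close>, where \<open>D\<close> is the
  defect space of \<open>X\<close>, represented by \<open>H\<close> with the defect form.\<close>

definition dilation_form :: "('h::complex_inner \<Rightarrow> 'h) \<Rightarrow> 'h ^ 3 \<Rightarrow> 'h ^ 3 \<Rightarrow> complex"
  where "dilation_form X x y = cinner (x $ 1) (y $ 1) + defect X (x $ 2) (y $ 2) + defect X (x $ 3) (y $ 3)"

text \<open>Three isometric copies of \<open>H\<close> in the dilation space, for \<open>n \<le> 2\<close>. If \<open>U\<close> is the unitary
  dilation of \<open>X\<close> and \<open>H\<close> its copy of level \<open>0\<close>, then level \<open>n\<close> is \<open>U\<^sup>n H\<close>. Multiplication by \<open>U\<close> has thereby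
  become a change of levels, and the compression of level \<open>m + n\<close> to level \<open>m\<close> is \<open>X\<^sup>n\<close>.\<close>

definition level :: "('h::complex_inner \<Rightarrow> 'h) \<Rightarrow> nat \<Rightarrow> 'h \<Rightarrow> 'h ^ 3"
  where "level X n h = (if n = 0 then vector [h, 0, 0] else if n = 1 then vector [X h, h, 0]
    else vector [X (X h), X h, h])"

lemma dilation_form_level:
  assumes X: "complex_linear X" and "n + m \<le> 2"
  shows "dilation_form X (level X (m + n) h) (level X m g) = cinner ((X ^^ n) h) g"
proof -
  interpret c: psd_form "cinner :: 'a \<Rightarrow> 'a \<Rightarrow> complex" by (rule psd_form_cinner)
  consider "n = 0" "m = 0" | "n = 0" "m = 1" | "n = 0" "m = 2"
    | "n = 1" "m = 0" | "n = 1" "m = 1" | "n = 2" "m = 0"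
    using \<open>n + m \<le> 2\<close> by linarith
  then show ?thesis
    by cases (simp_all add: dilation_form_def level_def defect_def numeral_2_eq_2 complex_linear_0[OF X])
qed

lemma psd_form_dilation_form:
  assumes "complex_linear X" "\<And>h. norm (X h) \<le> norm h"
  shows "psd_form (dilation_form X)"
  unfolding dilation_form_def[abs_def]
  using psd_form_plus[OF psd_form_plus[OF
      psd_form_pullback[OF psd_form_cinner complex_linear_vec_nth[of 1]]
      psd_form_pullback[OF psd_form_defect[OF assms] complex_linear_vec_nth[of 2]]]
      psd_form_pullback[OF psd_form_defect[OF assms] complex_linear_vec_nth[of 3]]] .

text \<open>The heart of the proof, a commutant lifting theorem for the levels. The isometries
  \<open>Va : H \<rightarrow> H \<oplus> D\<close> and \<open>Vb : H \<oplus> D \<rightarrow> H \<oplus> D \<oplus> D\<close>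
  are two successive steps of the isometric dilation of \<open>X\<close>. A lifting \<open>Cb\<close> of \<open>Y\<close> to a contraction
  \<open>H \<oplus> D \<rightarrow> H \<oplus> D \<oplus> D\<close> has first component \<open>Y\<close>, and it has to satisfy
  \<open>Cb (Va h) = Vb (Y h, 0)\<close>. This prescribes its remaining components on the range of \<open>Va\<close>. There they
  satisfy the bound that contractivity of \<open>Cb\<close> requires, because
  \<open>\<parallel>Y f\<parallel>\<^sup>2 - \<parallel>X Y f\<parallel>\<^sup>2 \<le> \<parallel>f\<parallel>\<^sup>2 - \<parallel>Y X f\<parallel>\<^sup>2\<close>; commutativity enters here.
  Composition with a least squares projection extends them with the same bound. Finally \<open>Cb\<close>,
  composed with a least squares inverse of \<open>Vb\<close>, is a contraction \<open>C\<close> of the dilation space into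
  itself.

  All identities hold up to null vectors, and only for vectors of the finite set \<open>S\<close>; this is what
  makes the projections elementary.\<close>

lemma commutant_lifting_on_finite_set:
  fixes X Y :: "'h::complex_inner \<Rightarrow> 'h"
  assumes X: "complex_linear X" "\<And>h. norm (X h) \<le> norm h"
    and Y: "complex_linear Y" "\<And>h. norm (Y h) \<le> norm h"
    and commute: "\<And>h. X (Y h) = Y (X h)"
    and "finite S"
  shows "\<exists>C. complex_linear C
    \<and> (\<forall>x. Re (dilation_form X (C x) (C x)) \<le> Re (dilation_form X x x))
    \<and> (\<forall>n k m. \<forall>h\<in>S. \<forall>g. n + k + m \<le> 2 \<longrightarrow>
        dilation_form X ((C ^^ k) (level X (m + n + k) h)) (level X m g)
          = cinner ((X ^^ n) ((Y ^^ k) h)) g)"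
proof -
  let ?Q = "dilation_form X"
  interpret Q: psd_form ?Q by (rule psd_form_dilation_form[OF X])
  interpret dX: psd_form "defect X" by (rule psd_form_defect[OF X])
  interpret dY: psd_form "defect Y" by (rule psd_form_defect[OF Y])
  interpret c: psd_form "cinner :: 'h \<Rightarrow> 'h \<Rightarrow> complex" by (rule psd_form_cinner)
  \<comment> \<open>The squared norm of \<open>(h, d)\<close> in \<open>H \<oplus> D\<close> minus \<open>\<parallel>Y h\<parallel>\<^sup>2\<close>: what \<open>Cb\<close> may spend on the components
    other than the first.\<close>
  define E :: "'h ^ 2 \<Rightarrow> 'h ^ 2 \<Rightarrow> complex"
    where "E x y = defect Y (x $ 1) (y $ 1) + defect X (x $ 2) (y $ 2)" for x y
  interpret E: psd_form E
    unfolding E_def[abs_def]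
    using psd_form_plus[OF
        psd_form_pullback[OF psd_form_defect[OF Y] complex_linear_vec_nth[of 1]]
        psd_form_pullback[OF psd_form_defect[OF X] complex_linear_vec_nth[of 2]]] .
  define Va :: "'h \<Rightarrow> 'h ^ 2" where "Va h = vector [X h, h]" for h
  define Vb :: "'h ^ 2 \<Rightarrow> 'h ^ 3" where "Vb x = vector [X (x $ 1), x $ 1, x $ 2]" for x
  note X_simps = complex_linear_add[OF X(1)] complex_linear_scaleC[OF X(1)] complex_linear_0[OF X(1)]
    complex_linear_diff[OF X(1)]
  note Y_simps = complex_linear_add[OF Y(1)] complex_linear_scaleC[OF Y(1)] complex_linear_0[OF Y(1)]
    complex_linear_diff[OF Y(1)]
  have Va: "complex_linear Va"
    by (simp add: complex_linear_def Va_def vec_eq_iff forall_2 X_simps)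
  have Vb: "complex_linear Vb"
    by (simp add: complex_linear_def Vb_def vec_eq_iff forall_3 X_simps)
  obtain \<pi>a where \<pi>a: "complex_linear \<pi>a"
    and \<pi>a_S: "\<And>x s. s \<in> S \<Longrightarrow> E (x - Va (\<pi>a x)) (Va s) = 0"
    and \<pi>a_orth: "\<And>x y. E (x - Va (\<pi>a x)) (Va (\<pi>a y)) = 0"
    using E.least_squares[OF \<open>finite S\<close> Va] by blast
  \<comment> \<open>The vectors at which the inverse of \<open>Vb\<close> has to be exact: those giving level \<open>1\<close> at \<open>S\<close> and, for the
    second application of \<open>C\<close>, at \<open>Y ` S\<close>, and those giving level \<open>2\<close> at \<open>S\<close>.\<close>
  define S' where "S' = (\<lambda>h. vector [h, 0] :: 'h ^ 2) ` (S \<union> Y ` S) \<union> Va ` S"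
  have "finite S'" using \<open>finite S\<close> by (simp add: S'_def)
  obtain \<pi>b where \<pi>b: "complex_linear \<pi>b"
    and \<pi>b_S: "\<And>x s. s \<in> S' \<Longrightarrow> ?Q (x - Vb (\<pi>b x)) (Vb s) = 0"
    and \<pi>b_orth: "\<And>x y. ?Q (x - Vb (\<pi>b x)) (Vb (\<pi>b y)) = 0"
    using Q.least_squares[OF \<open>finite S'\<close> Vb] by blast
  define Cb :: "'h ^ 2 \<Rightarrow> 'h ^ 3" where "Cb x = vector [Y (x $ 1), Y (\<pi>a x), 0]" for x
  have Cb: "complex_linear Cb"
    by (simp add: complex_linear_def Cb_def vec_eq_iff forall_3 Y_simps
        complex_linear_add[OF \<pi>a] complex_linear_scaleC[OF \<pi>a])
  define C where "C x = Cb (\<pi>b x)" for x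
  have C: "complex_linear C"
    unfolding C_def[abs_def] by (rule complex_linear_compose[OF Cb \<pi>b])
  have E_Va: "Re (defect X (Y f) (Y f)) \<le> Re (E (Va f) (Va f))" for f
    using Y(2)[of f] by (simp add: E_def Va_def defect_def Re_cinner_self commute power_mono)
  have pyth_a: "Re (E (Va (\<pi>a x)) (Va (\<pi>a x))) \<le> Re (E x x)" for x
  proof -
    have "E x x = E (x - Va (\<pi>a x)) (x - Va (\<pi>a x)) + E (Va (\<pi>a x)) (Va (\<pi>a x))"
      using \<pi>a_orth[of x x] E.hermitian[of "Va (\<pi>a x)" "x - Va (\<pi>a x)"]
      by (simp add: E.diff_left E.diff_right)
    then show ?thesis using E.nonneg[of "x - Va (\<pi>a x)"] by simp
  qed
  have pyth_b: "Re (?Q (Vb (\<pi>b x)) (Vb (\<pi>b x))) \<le> Re (?Q x x)" for x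
  proof -
    have "?Q x x = ?Q (x - Vb (\<pi>b x)) (x - Vb (\<pi>b x)) + ?Q (Vb (\<pi>b x)) (Vb (\<pi>b x))"
      using \<pi>b_orth[of x x] Q.hermitian[of "Vb (\<pi>b x)" "x - Vb (\<pi>b x)"]
      by (simp add: Q.diff_left Q.diff_right)
    then show ?thesis using Q.nonneg[of "x - Vb (\<pi>b x)"] by simp
  qed
  have Cb_contractive: "Re (?Q (Cb x) (Cb x)) \<le> Re (?Q (Vb x) (Vb x))" for x
  proof -
    have "Re (?Q (Cb x) (Cb x)) = Re (cinner (Y (x $ 1)) (Y (x $ 1))) + Re (defect X (Y (\<pi>a x)) (Y (\<pi>a x)))"
      by (simp add: dilation_form_def Cb_def)
    also have "\<dots> \<le> Re (cinner (Y (x $ 1)) (Y (x $ 1))) + Re (E x x)"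
      using E_Va[of "\<pi>a x"] pyth_a[of x] by simp
    also have "\<dots> = Re (?Q (Vb x) (Vb x))"
      by (simp add: E_def dilation_form_def Vb_def defect_def)
    finally show ?thesis .
  qed
  have C_contractive: "Re (?Q (C x) (C x)) \<le> Re (?Q x x)" for x
    using Cb_contractive[of "\<pi>b x"] pyth_b[of x] by (simp add: C_def)
  \<comment> \<open>Two vectors with the same products differ by a null vector, which the contraction \<open>C\<close> keeps null.\<close>
  have C_cong: "?Q (C a) g = ?Q (C b) g" if "\<And>g. ?Q a g = ?Q b g" for a b g
  proof -
    have "?Q (a - b) (a - b) = 0" by (simp add: Q.diff_left that)
    then have "Re (?Q (C (a - b)) (C (a - b))) = 0"
      using C_contractive[of "a - b"] Q.nonneg[of "C (a - b)"] by simp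
    from Q.null_left[OF this, of g] show ?thesis
      by (simp add: complex_linear_diff[OF C] Q.diff_left)
  qed
  have C_Vb: "?Q (C (Vb s)) g = ?Q (Cb s) g" if "s \<in> S'" for s g
  proof -
    let ?z = "Vb s - Vb (\<pi>b (Vb s))"
    have "?Q ?z ?z = 0"
      using \<pi>b_S[OF that, of "Vb s"] \<pi>b_orth[of "Vb s" "Vb s"] by (simp add: Q.diff_right)
    moreover have "?z = Vb (s - \<pi>b (Vb s))" by (simp add: complex_linear_diff[OF Vb])
    ultimately have "Re (?Q (Cb (s - \<pi>b (Vb s))) (Cb (s - \<pi>b (Vb s)))) = 0"
      using Cb_contractive[of "s - \<pi>b (Vb s)"] Q.nonneg[of "Cb (s - \<pi>b (Vb s))"] by simp
    from Q.null_left[OF this, of g] show ?thesis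
      by (simp add: complex_linear_diff[OF Cb] Q.diff_left C_def)
  qed
  have level1: "level X 1 h = Vb (vector [h, 0])" for h
    by (simp add: level_def Vb_def)
  have level2: "level X 2 h = Vb (Va h)" for h
    by (simp add: level_def Vb_def Va_def)
  have Cb_Va: "?Q (Cb (Va h)) g = ?Q (level X 1 (Y h)) g" if h: "h \<in> S" for h g
  proof -
    let ?f = "\<pi>a (Va h) - h"
    let ?z = "Va h - Va (\<pi>a (Va h))"
    have "E ?z ?z = 0"
      using \<pi>a_S[OF h, of "Va h"] \<pi>a_orth[of "Va h" "Va h"] by (simp add: E.diff_right)
    moreover have "E ?z ?z = E (Va ?f) (Va ?f)"
      by (simp add: complex_linear_diff[OF Va] E.diff_left E.diff_right)
    ultimately have "Re (defect X (Y ?f) (Y ?f)) = 0"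
      using E_Va[of ?f] dX.nonneg[of "Y ?f"] by simp
    then have "defect X (Y ?f) (g $ 2) = 0" by (rule dX.null_left)
    then show ?thesis
      by (simp add: dilation_form_def level_def Cb_def Va_def commute Y_simps dX.diff_left)
  qed
  have CV1: "?Q (C (level X 1 h)) (level X 0 g) = cinner (Y h) g" if "h \<in> S \<union> Y ` S" for h g
  proof -
    have "vector [h, 0] \<in> S'" using that by (auto simp: S'_def)
    moreover have "?Q (Cb (vector [h, 0])) (level X 0 g) = cinner (Y h) g"
      by (simp add: dilation_form_def Cb_def level_def)
    ultimately show ?thesis by (simp only: level1 C_Vb)
  qed
  \<comment> \<open>\<open>C\<close> carries level \<open>2\<close> to level \<open>1\<close>, acting as \<open>Y\<close>; on level \<open>1\<close> only its compression to level \<open>0\<close> is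
    \<open>Y\<close>.\<close>
  have CV2: "?Q (C (level X 2 h)) g = ?Q (level X 1 (Y h)) g" if "h \<in> S" for h g
  proof -
    have "Va h \<in> S'" using that by (auto simp: S'_def)
    from C_Vb[OF this] show ?thesis using Cb_Va[OF that] by (simp add: level2)
  qed
  have "?Q ((C ^^ k) (level X (m + n + k) h)) (level X m g) = cinner ((X ^^ n) ((Y ^^ k) h)) g"
    if h: "h \<in> S" and le: "n + k + m \<le> 2" for n k m h g
  proof -
    consider "k = 0" | "k = 1" "n = 0" "m = 0" | "k = 1" "m + n = 1" | "k = 2" "n = 0" "m = 0"
      using le by linarith
    then show ?thesis
    proof cases
      case 1
      then show ?thesis using dilation_form_level[OF X(1), of n m] le by simp
    next
      case 2
      then show ?thesis using CV1[of h g] h by simp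
    next
      case 3
      then have "?Q ((C ^^ k) (level X (m + n + k) h)) (level X m g) = ?Q (level X (m + n) (Y h)) (level X m g)"
        using CV2[OF h] by (simp add: numeral_2_eq_2)
      then show ?thesis using dilation_form_level[OF X(1), of n m "Y h"] 3 by simp
    next
      case 4
      have "?Q (C (C (level X 2 h))) (level X 0 g) = ?Q (C (level X 1 (Y h))) (level X 0 g)"
        by (rule C_cong) (rule CV2[OF h])
      also have "\<dots> = cinner (Y (Y h)) g" using CV1[of "Y h" g] h by simp
      finally show ?thesis using 4 by (simp add: numeral_2_eq_2)
    qed
  qed
  then show ?thesis using C C_contractive by blast
qed

section \<open>Trigonometric polynomials with coefficients in the three levels\<close>

definition fourier_polynomial :: "(nat \<Rightarrow> 'k::complex_inner) \<Rightarrow> complex \<Rightarrow> 'k"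
  where "fourier_polynomial u z = (\<Sum>a<3. (cnj z) ^ a *\<^sub>C u a)"

text \<open>The average over \<open>z\<close> selects the pairs of levels \<open>a\<close>, \<open>b\<close> whose difference is the total degree
  \<open>m + n\<close>, just as the nilpotent shift does; the average over the second root of unity produces
  \<open>C\<^sup>n\<close>. In particular all monomials of total degree above \<open>2\<close> disappear, and \<open>N > 2\<close> suffices.\<close>

lemma torus_mean_fejer_form:
  fixes u v :: "nat \<Rightarrow> 'k::complex_inner"
  assumes q: "psd_form q" and C: "complex_linear C"
    and contractive: "\<And>x. Re (q (C x) (C x)) \<le> Re (q x x)"
    and N: "2 < N" and M: "m + n + N + 3 < M"
  shows "(\<Sum>s<M. \<Sum>t<M. unit_root M s ^ m * (unit_root M s * unit_root M t) ^ n *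
      fejer_form q C N (unit_root M t) (fourier_polynomial u (unit_root M s))
        (fourier_polynomial v (unit_root M s)))
    = (of_nat M)\<^sup>2 * of_real (1 - real n / real N) *
      (\<Sum>b<3. if m + n + b < 3 then q ((C ^^ n) (u (m + n + b))) (v b) else 0)"
proof -
  let ?z = "unit_root M"
  let ?F = "\<lambda>t. fejer_form q C N (?z t)"
  have expand: "?z s ^ m * (?z s * ?z t) ^ n *
      ?F t (fourier_polynomial u (?z s)) (fourier_polynomial v (?z s))
    = (\<Sum>b<3. \<Sum>a<3. (?z s ^ (m + n + b) * cnj (?z s) ^ a) * (?z t ^ n * ?F t (u a) (v b)))" for s t
  proof -
    interpret F: psd_form "?F t"
      by (rule psd_form_fejer_form[OF q C contractive]) simp
    show ?thesis
      unfolding fourier_polynomial_def F.sum_right F.scale_right F.sum_left F.scale_left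
      by (simp add: sum_distrib_left power_add power_mult_distrib mult_ac)
  qed
  have "(\<Sum>s<M. \<Sum>t<M. ?z s ^ m * (?z s * ?z t) ^ n *
      ?F t (fourier_polynomial u (?z s)) (fourier_polynomial v (?z s)))
    = (\<Sum>s<M. \<Sum>b<3. \<Sum>t<M. \<Sum>a<3. (?z s ^ (m + n + b) * cnj (?z s) ^ a) * (?z t ^ n * ?F t (u a) (v b)))"
    unfolding expand by (intro sum.cong refl sum.swap)
  also have "\<dots> = (\<Sum>b<3. \<Sum>s<M. \<Sum>t<M. \<Sum>a<3. (?z s ^ (m + n + b) * cnj (?z s) ^ a) * (?z t ^ n * ?F t (u a) (v b)))"
    by (rule sum.swap)
  also have "\<dots> = (\<Sum>b<3. (of_nat M)\<^sup>2 * of_real (1 - real n / real N) *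
      (if m + n + b < 3 then q ((C ^^ n) (u (m + n + b))) (v b) else 0))"
  proof (rule sum.cong[OF refl])
    fix b :: nat assume b: "b \<in> {..<3}"
    have "(\<Sum>s<M. \<Sum>t<M. \<Sum>a<3. (?z s ^ (m + n + b) * cnj (?z s) ^ a) * (?z t ^ n * ?F t (u a) (v b)))
      = (\<Sum>s<M. \<Sum>a<3. \<Sum>t<M. (?z s ^ (m + n + b) * cnj (?z s) ^ a) * (?z t ^ n * ?F t (u a) (v b)))"
      by (intro sum.cong refl sum.swap)
    also have "\<dots> = (\<Sum>a<3. \<Sum>s<M. \<Sum>t<M. (?z s ^ (m + n + b) * cnj (?z s) ^ a) * (?z t ^ n * ?F t (u a) (v b)))"
      by (rule sum.swap)
    also have "\<dots> = (\<Sum>a<3. (\<Sum>s<M. ?z s ^ (m + n + b) * cnj (?z s) ^ a) * (\<Sum>t<M. ?z t ^ n * ?F t (u a) (v b)))"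
      by (simp only: sum_product)
    also have "\<dots> = (\<Sum>a<3. if m + n + b = a then of_nat M * (\<Sum>t<M. ?z t ^ n * ?F t (u a) (v b)) else 0)"
    proof (rule sum.cong[OF refl])
      fix a :: nat assume "a \<in> {..<3}"
      then have "a < M" "m + n + b < M" using b M by auto
      from sum_unit_roots[OF this(2,1)]
      show "(\<Sum>s<M. ?z s ^ (m + n + b) * cnj (?z s) ^ a) * (\<Sum>t<M. ?z t ^ n * ?F t (u a) (v b))
        = (if m + n + b = a then of_nat M * (\<Sum>t<M. ?z t ^ n * ?F t (u a) (v b)) else 0)"
        by simp
    qed
    also have "\<dots> = (if m + n + b < 3 then of_nat M * (\<Sum>t<M. ?z t ^ n * ?F t (u (m + n + b)) (v b)) else 0)"
      by simp
    also have "\<dots> = (of_nat M)\<^sup>2 * of_real (1 - real n / real N) *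
      (if m + n + b < 3 then q ((C ^^ n) (u (m + n + b))) (v b) else 0)"
      using sum_fejer_form[OF q C, of n N M "u (m + n + b)" "v b"] N M
      by (simp add: power2_eq_square)
    finally show "(\<Sum>s<M. \<Sum>t<M. \<Sum>a<3. (?z s ^ (m + n + b) * cnj (?z s) ^ a) * (?z t ^ n * ?F t (u a) (v b)))
      = (of_nat M)\<^sup>2 * of_real (1 - real n / real N) *
      (if m + n + b < 3 then q ((C ^^ n) (u (m + n + b))) (v b) else 0)" .
  qed
  finally show ?thesis by (simp only: sum_distrib_left)
qed

section \<open>Varopoulos operators in terms of levels\<close>

text \<open>The component of level \<open>n\<close>, extended by zero so that a Varopoulos operator is a shift of
  levels without a boundary case.\<close>

definition coord :: "'h::complex_inner ^ 3 \<Rightarrow> nat \<Rightarrow> 'h"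
  where "coord x n = (if n = 0 then x $ 1 else if n = 1 then x $ 2 else if n = 2 then x $ 3 else 0)"

lemma cinner_coord: "cinner x y = (\<Sum>b<3. cinner (coord x b) (coord y b))"
  by (simp add: cinner_vec_def sum_3 coord_def eval_nat_numeral)

lemma coord_varopoulosII:
  assumes "complex_linear X"
  shows "coord (varopoulosII X x) n = X (coord x (Suc n))"
  using complex_linear_0[OF assms] by (simp add: coord_def varopoulosII_def)

lemma coord_varopoulosII_funpow:
  assumes "complex_linear X"
  shows "coord ((varopoulosII X ^^ p) x) n = (X ^^ p) (coord x (n + p))"
  by (induction p arbitrary: n) (simp_all add: coord_varopoulosII[OF assms])

text \<open>\<open>X\<close> is the restriction of its Varopoulos operator to the middle component.\<close>

lemma varopoulosII_contractiveD:
  assumes X: "complex_linear X" and "contraction (varopoulosII X)"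
  shows "norm (X h) \<le> norm h"
proof -
  let ?T = "varopoulosII X"
  let ?x = "vector [0, h, 0] :: 'a ^ 3"
  have T: "bounded_linear ?T" "onorm ?T \<le> 1"
    using assms(2) by (auto simp: contraction_def bounded_clinear_def)
  have "norm (?T ?x) \<le> onorm ?T * norm ?x" by (rule onorm[OF T(1)])
  also have "\<dots> \<le> 1 * norm ?x" using T(2) by (rule mult_right_mono) simp
  finally have "norm (?T ?x) \<le> norm ?x" by simp
  moreover have "norm (?T ?x) = norm (X h)"
    by (simp add: norm_vec_def L2_set_def sum_3 varopoulosII_def complex_linear_0[OF X])
  moreover have "norm ?x = norm h" by (simp add: norm_vec_def L2_set_def sum_3)
  ultimately show ?thesis by simp
qed

lemma varopoulosII_commuteD:
  assumes X: "complex_linear X" "complex_linear Y"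
    and "varopoulosII X \<circ> varopoulosII Y = varopoulosII Y \<circ> varopoulosII X"
  shows "X (Y h) = Y (X h)"
proof -
  have "(varopoulosII X \<circ> varopoulosII Y) (vector [0, 0, h]) $ 1
      = (varopoulosII Y \<circ> varopoulosII X) (vector [0, 0, h]) $ 1"
    using assms(3) by simp
  then show ?thesis by (simp add: varopoulosII_def)
qed

section \<open>The bidisc norm\<close>

lemma matpoly_eval_entry:
  "matpoly_eval P z w $ i $ j =
    (\<Sum>k\<in>Poly_Mapping.keys P. z ^ fst k * w ^ snd k * Poly_Mapping.lookup P k $ i $ j)"
  by (simp add: matpoly_eval_def scaleC_complex_def case_prod_beta)

lemma matpoly_bidisc_norm_nonneg: "0 \<le> matpoly_bidisc_norm P"
proof -
  have "0 \<le> onorm (\<lambda>v. matpoly_eval P 0 0 *v v)"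
    by (rule onorm_pos_le) (rule matrix_vector_mul_bounded_linear)
  also have "\<dots> \<le> matpoly_bidisc_norm P"
    unfolding matpoly_bidisc_norm_def
    by (rule cSUP_upper2[OF bdd_above_matpoly_bidisc, of "(0, 0)"]) auto
  finally show ?thesis .
qed

text \<open>The supremum is over the open bidisc; torus points are reached as limits along radii.\<close>

lemma norm_matpoly_eval_le_on_torus:
  assumes "cmod z = 1" "cmod w = 1"
  shows "norm (matpoly_eval P z w *v u) \<le> matpoly_bidisc_norm P * norm u"
proof (rule LIMSEQ_le_const2)
  define r where "r n = complex_of_real (1 - 1 / real (Suc n))" for n
  let ?f = "\<lambda>n. matpoly_eval P (r n * z) (r n * w) *v u"
  have r: "r \<longlonglongrightarrow> 1"
  proof -
    have "(\<lambda>n. complex_of_real (1 - 1 / real (Suc n))) \<longlonglongrightarrow> complex_of_real (1 - 0)"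
      by (intro tendsto_of_real tendsto_diff tendsto_const LIMSEQ_Suc lim_const_over_n)
    then show ?thesis by (simp add: r_def[abs_def])
  qed
  have "?f \<longlonglongrightarrow> matpoly_eval P (1 * z) (1 * w) *v u"
    by (rule vec_tendstoI)
      (simp only: matrix_vector_mult_def vec_lambda_beta matpoly_eval_entry,
        intro tendsto_intros r)
  then show "(\<lambda>n. norm (?f n)) \<longlonglongrightarrow> norm (matpoly_eval P z w *v u)"
    by (auto intro: tendsto_norm)
  have "norm (?f n) \<le> matpoly_bidisc_norm P * norm u" for n
  proof -
    have "cmod (r n) < 1" by (simp only: r_def norm_of_real) (simp add: divide_simps)
    then have mem: "(r n * z, r n * w) \<in> ball 0 1 \<times> ball 0 1"
      using assms by (simp add: norm_mult)
    have "norm (?f n) \<le> onorm (\<lambda>v. matpoly_eval P (r n * z) (r n * w) *v v) * norm u"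
      by (rule onorm) (rule matrix_vector_mul_bounded_linear)
    also have "\<dots> \<le> matpoly_bidisc_norm P * norm u"
      unfolding matpoly_bidisc_norm_def
      by (intro mult_right_mono cSUP_upper2[OF bdd_above_matpoly_bidisc mem]) auto
    finally show ?thesis .
  qed
  then show "\<exists>n0. \<forall>n\<ge>n0. norm (?f n) \<le> matpoly_bidisc_norm P * norm u" by blast
qed

section \<open>The von Neumann inequality\<close>

text \<open>The sesquilinear form of a Fejer mean of \<open>P(T\<^sub>X, T\<^sub>Y)\<close> at \<open>v\<close>, \<open>w\<close> is an average over \<open>(z, \<omega>)\<close> of the
  matrices \<open>P(z, z \<omega>)\<close>, amplified with respect to the Fejer kernel of the lifted contraction at \<open>\<omega>\<close>.
  Every one of these is bounded by the bidisc norm, and the averages of the squared lengths give back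
  \<open>\<parallel>v\<parallel>\<^sup>2\<close> and \<open>\<parallel>w\<parallel>\<^sup>2\<close>. The lifting depends on \<open>v\<close>, whose components are the finite set of vectors at
  which it has to be exact; \<open>w\<close> is arbitrary.\<close>

lemma fejer_mean_le:
  fixes X Y :: "'h::complex_inner \<Rightarrow> 'h" and P :: "'l::finite matpoly2" and v w :: "('h ^ 3) ^ 'l"
  assumes X: "complex_linear X" "\<And>h. norm (X h) \<le> norm h"
    and Y: "complex_linear Y" "\<And>h. norm (Y h) \<le> norm h"
    and commute: "\<And>h. X (Y h) = Y (X h)"
    and N: "2 < N"
  shows "(\<Sum>k\<in>Poly_Mapping.keys P. (1 - real (snd k) / real N) *
      inner (mat_tensor (Poly_Mapping.lookup P k) (varopoulosII X ^^ fst k \<circ> varopoulosII Y ^^ snd k) v) w)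
    \<le> matpoly_bidisc_norm P / 2 * ((norm v)\<^sup>2 + (norm w)\<^sup>2)"
proof -
  let ?K = "Poly_Mapping.keys P" and ?c = "matpoly_bidisc_norm P" and ?A = "Poly_Mapping.lookup P"
  let ?T = "\<lambda>k. varopoulosII X ^^ fst k \<circ> varopoulosII Y ^^ snd k"
  let ?Q = "dilation_form X"
  have Q: "psd_form ?Q" by (rule psd_form_dilation_form[OF X])
  interpret c: psd_form "cinner :: 'h \<Rightarrow> 'h \<Rightarrow> complex" by (rule psd_form_cinner)
  define S where "S = (\<lambda>(j, b). coord (v $ j) b) ` (UNIV \<times> {..<3})"
  have "finite S" by (simp add: S_def)
  from commutant_lifting_on_finite_set[OF X Y commute this] obtain C where C: "complex_linear C"
    and contractive: "\<And>x. Re (?Q (C x) (C x)) \<le> Re (?Q x x)"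
    and lift: "\<And>n k m h g. h \<in> S \<Longrightarrow> n + k + m \<le> 2 \<Longrightarrow>
      ?Q ((C ^^ k) (level X (m + n + k) h)) (level X m g) = cinner ((X ^^ n) ((Y ^^ k) h)) g"
    by blast
  \<comment> \<open>An order of roots of unity beyond all exponents: those of \<open>P\<close>, those of the kernel, and the levels.\<close>
  define M where "M = N + 4 + (\<Sum>k\<in>?K. fst k + snd k)"
  have M: "fst k + snd k + N + 3 < M" if "k \<in> ?K" for k
    using member_le_sum[OF that, of "\<lambda>k. fst k + snd k"] by (simp add: M_def)
  have M0: "0 + 0 + N + 3 < M" by (simp add: M_def)
  let ?z = "unit_root M"
  let ?F = "\<lambda>t. fejer_form ?Q C N (?z t)"
  define lev where "lev x a = level X a (coord x a)" for x a
  let ?x = "\<lambda>s x. fourier_polynomial (lev x) (?z s)"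
  have mean: "(\<Sum>s<M. \<Sum>t<M. ?z s ^ fst k * (?z s * ?z t) ^ snd k * ?F t (?x s (v $ j)) (?x s (w $ i)))
      = (of_nat M)\<^sup>2 * of_real (1 - real (snd k) / real N) * cinner (?T k (v $ j)) (w $ i)"
    if "k \<in> ?K" for k i j
  proof -
    have "?Q ((C ^^ snd k) (lev (v $ j) (fst k + snd k + b))) (lev (w $ i) b)
        = cinner (coord (?T k (v $ j)) b) (coord (w $ i) b)" if "fst k + snd k + b < 3" for b
    proof -
      have "coord (v $ j) (fst k + snd k + b) \<in> S" using that by (auto simp: S_def)
      from lift[OF this, of "fst k" "snd k" b] that show ?thesis
        by (simp add: lev_def coord_varopoulosII_funpow[OF X(1)] coord_varopoulosII_funpow[OF Y(1)] add_ac)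
    qed
    moreover have "cinner (coord (?T k (v $ j)) b) (coord (w $ i) b) = 0" if "\<not> fst k + snd k + b < 3" for b
    proof -
      have "coord (v $ j) (b + fst k + snd k) = 0" using that by (auto simp: coord_def)
      then show ?thesis
        by (simp add: coord_varopoulosII_funpow[OF X(1)] coord_varopoulosII_funpow[OF Y(1)]
            complex_linear_0[OF complex_linear_funpow[OF X(1)]] complex_linear_0[OF complex_linear_funpow[OF Y(1)]])
    qed
    ultimately have "(\<Sum>b<3. if fst k + snd k + b < 3
        then ?Q ((C ^^ snd k) (lev (v $ j) (fst k + snd k + b))) (lev (w $ i) b) else 0)
      = cinner (?T k (v $ j)) (w $ i)"
      unfolding cinner_coord[of "?T k (v $ j)"] by (intro sum.cong refl) simp
    then show ?thesis
      by (simp only: torus_mean_fejer_form[OF Q C contractive N M[OF that]])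
  qed
  have mean_norm: "(\<Sum>s<M. \<Sum>t<M. Re (?F t (?x s y) (?x s y))) = (real M)\<^sup>2 * (norm y)\<^sup>2" for y
  proof -
    have "?Q (lev y b) (lev y b) = cinner (coord y b) (coord y b)" if "b < 3" for b
      using dilation_form_level[OF X(1), of 0 b "coord y b" "coord y b"] that by (simp add: lev_def)
    then have "(\<Sum>b<3. ?Q (lev y b) (lev y b)) = cinner y y"
      unfolding cinner_coord[of y] by (intro sum.cong refl) simp
    then have "(\<Sum>s<M. \<Sum>t<M. ?F t (?x s y) (?x s y)) = (of_nat M)\<^sup>2 * cinner y y"
      using torus_mean_fejer_form[OF Q C contractive N M0, of "lev y" "lev y"] by simp
    then have "Re (\<Sum>s<M. \<Sum>t<M. ?F t (?x s y) (?x s y)) = Re (of_real ((real M)\<^sup>2) * cinner y y)"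
      by simp
    then show ?thesis by (simp only: Re_sum Re_cinner_self Re_complex_of_real
          times_complex.sel Im_complex_of_real)
  qed
  have norm_sum: "(\<Sum>j\<in>UNIV. (norm (y $ j))\<^sup>2) = (norm y)\<^sup>2" for y :: "('h ^ 3) ^ 'l"
    by (simp add: norm_vec_def[of y] L2_set_def sum_nonneg)
  define G where "G s t = (\<Sum>i\<in>UNIV. \<Sum>j\<in>UNIV. matpoly_eval P (?z s) (?z s * ?z t) $ i $ j
      * ?F t (?x s (v $ j)) (?x s (w $ i)))" for s t
  have G_le: "Re (G s t) \<le> ?c / 2 * ((\<Sum>j\<in>UNIV. Re (?F t (?x s (v $ j)) (?x s (v $ j))))
      + (\<Sum>i\<in>UNIV. Re (?F t (?x s (w $ i)) (?x s (w $ i)))))" for s t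
    unfolding G_def
    by (intro psd_form.matrix_amplification psd_form_fejer_form[OF Q C contractive]
        norm_matpoly_eval_le_on_torus matpoly_bidisc_norm_nonneg)
      (simp_all add: norm_mult)
  have "(\<Sum>s<M. \<Sum>t<M. G s t)
      = (\<Sum>k\<in>?K. \<Sum>i\<in>UNIV. \<Sum>j\<in>UNIV. ?A k $ i $ j *
        (\<Sum>s<M. \<Sum>t<M. ?z s ^ fst k * (?z s * ?z t) ^ snd k * ?F t (?x s (v $ j)) (?x s (w $ i))))"
  proof -
    have "(\<Sum>s<M. \<Sum>t<M. G s t) = (\<Sum>(s, t)\<in>{..<M} \<times> {..<M}. \<Sum>(i, j)\<in>UNIV \<times> UNIV. \<Sum>k\<in>?K.
        ?A k $ i $ j * (?z s ^ fst k * (?z s * ?z t) ^ snd k * ?F t (?x s (v $ j)) (?x s (w $ i))))"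
      unfolding G_def matpoly_eval_entry sum.cartesian_product[symmetric]
      by (simp add: sum_distrib_left sum_distrib_right mult_ac)
    also have "\<dots> = (\<Sum>(i, j)\<in>UNIV \<times> UNIV. \<Sum>(s, t)\<in>{..<M} \<times> {..<M}. \<Sum>k\<in>?K.
        ?A k $ i $ j * (?z s ^ fst k * (?z s * ?z t) ^ snd k * ?F t (?x s (v $ j)) (?x s (w $ i))))"
      unfolding case_prod_beta by (rule sum.swap)
    also have "\<dots> = (\<Sum>(i, j)\<in>UNIV \<times> UNIV. \<Sum>k\<in>?K. \<Sum>(s, t)\<in>{..<M} \<times> {..<M}.
        ?A k $ i $ j * (?z s ^ fst k * (?z s * ?z t) ^ snd k * ?F t (?x s (v $ j)) (?x s (w $ i))))"
      unfolding case_prod_beta by (intro sum.cong refl sum.swap)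
    also have "\<dots> = (\<Sum>k\<in>?K. \<Sum>(i, j)\<in>UNIV \<times> UNIV. \<Sum>(s, t)\<in>{..<M} \<times> {..<M}.
        ?A k $ i $ j * (?z s ^ fst k * (?z s * ?z t) ^ snd k * ?F t (?x s (v $ j)) (?x s (w $ i))))"
      unfolding case_prod_beta by (rule sum.swap)
    finally show ?thesis
      unfolding sum.cartesian_product[symmetric] by (simp only: sum_distrib_left)
  qed
  also have "\<dots> = (\<Sum>k\<in>?K. \<Sum>i\<in>UNIV. \<Sum>j\<in>UNIV. ?A k $ i $ j *
        ((of_nat M)\<^sup>2 * of_real (1 - real (snd k) / real N) * cinner (?T k (v $ j)) (w $ i)))"
    by (intro sum.cong refl arg_cong2[of _ _ _ _ "(*)"] mean)
  also have "\<dots> = (\<Sum>k\<in>?K. of_real ((real M)\<^sup>2 * (1 - real (snd k) / real N)) *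
      cinner (mat_tensor (?A k) (?T k) v) w)"
  proof (rule sum.cong[OF refl])
    fix k
    interpret c3: psd_form "cinner :: 'h ^ 3 \<Rightarrow> 'h ^ 3 \<Rightarrow> complex" by (rule psd_form_cinner)
    have "cinner (mat_tensor (?A k) (?T k) v) w
        = (\<Sum>i\<in>UNIV. \<Sum>j\<in>UNIV. ?A k $ i $ j * cinner (?T k (v $ j)) (w $ i))"
      by (simp add: cinner_vec_def[of _ w] mat_tensor_def c3.sum_left c3.scale_left)
    then show "(\<Sum>i\<in>UNIV. \<Sum>j\<in>UNIV. ?A k $ i $ j *
        ((of_nat M)\<^sup>2 * of_real (1 - real (snd k) / real N) * cinner (?T k (v $ j)) (w $ i)))
      = of_real ((real M)\<^sup>2 * (1 - real (snd k) / real N)) * cinner (mat_tensor (?A k) (?T k) v) w"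
      by (simp add: sum_distrib_left mult_ac)
  qed
  finally have "Re (\<Sum>s<M. \<Sum>t<M. G s t) = (\<Sum>k\<in>?K. (real M)\<^sup>2 * (1 - real (snd k) / real N) *
      inner (mat_tensor (?A k) (?T k) v) w)"
    by (simp only: Re_sum times_complex.sel Re_complex_of_real Im_complex_of_real Re_cinner) simp
  then have "(real M)\<^sup>2 * (\<Sum>k\<in>?K. (1 - real (snd k) / real N) * inner (mat_tensor (?A k) (?T k) v) w)
      = (\<Sum>s<M. \<Sum>t<M. Re (G s t))"
    by (simp add: sum_distrib_left mult.assoc)
  also have "\<dots> \<le> (\<Sum>s<M. \<Sum>t<M. ?c / 2 * ((\<Sum>j\<in>UNIV. Re (?F t (?x s (v $ j)) (?x s (v $ j))))
      + (\<Sum>i\<in>UNIV. Re (?F t (?x s (w $ i)) (?x s (w $ i))))))"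
    by (intro sum_mono G_le)
  also have "\<dots> = ?c / 2 * ((\<Sum>j\<in>UNIV. \<Sum>s<M. \<Sum>t<M. Re (?F t (?x s (v $ j)) (?x s (v $ j))))
      + (\<Sum>i\<in>UNIV. \<Sum>s<M. \<Sum>t<M. Re (?F t (?x s (w $ i)) (?x s (w $ i)))))"
  proof -
    have "(\<Sum>s<M. \<Sum>t<M. \<Sum>j\<in>UNIV. f s t j) = (\<Sum>j\<in>UNIV. \<Sum>s<M. \<Sum>t<M. f s t j)"
      for f :: "nat \<Rightarrow> nat \<Rightarrow> 'l \<Rightarrow> real"
      by (subst sum.swap[of _ UNIV]) (intro sum.cong refl sum.swap)
    then show ?thesis
      by (simp only: sum_distrib_left[symmetric] sum.distrib)
  qed
  also have "\<dots> = (real M)\<^sup>2 * (?c / 2 * ((norm v)\<^sup>2 + (norm w)\<^sup>2))"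
    by (simp only: mean_norm sum_distrib_left[symmetric] norm_sum) (simp add: algebra_simps)
  finally show ?thesis
    using M0 by (simp only: mult_le_cancel_left) simp
qed

text \<open>The choice of \<open>w\<close> parallel to \<open>B v\<close> and of the same length as \<open>v\<close> turns the arithmetic mean back
  into the product of the norms.\<close>

lemma norm_le_of_inner_le:
  assumes B: "linear B" and le: "\<And>v w. inner (B v) w \<le> c / 2 * ((norm v)\<^sup>2 + (norm w)\<^sup>2)"
  shows "norm (B v) \<le> c * norm v"
proof (cases "v = 0 \<or> B v = 0")
  case True
  have "0 \<le> c" if "v \<noteq> 0"
    using le[of v 0] that by (simp add: zero_le_mult_iff)
  then show ?thesis using True linear_0[OF B] by (cases "v = 0") auto
next
  case False
  let ?w = "(norm v / norm (B v)) *\<^sub>R B v"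
  have "norm ?w = norm v" using False by simp
  moreover have "inner (B v) ?w = norm (B v) * norm v"
    using False by (simp add: dot_square_norm power2_eq_square)
  ultimately have "norm (B v) * norm v \<le> (c * norm v) * norm v"
    using le[of v ?w] by (simp add: power2_eq_square)
  then show ?thesis using False by simp
qed

lemma bounded_clinear_imp_complex_linear: "bounded_clinear f \<Longrightarrow> complex_linear f"
  by (auto simp: bounded_clinear_def complex_linear_def linear_add[OF bounded_linear.linear])

theorem theorem3p8:
  fixes X1 X2 :: "'h::chilbert_space \<Rightarrow> 'h"
    and P :: "'l::finite matpoly2"
  assumes separable: "separable_space (euclidean :: 'h topology)"
    and "bounded_clinear X1" and "bounded_clinear X2"
    and "contraction (varopoulosII X1)" and "contraction (varopoulosII X2)"
    and "varopoulosII X1 \<circ> varopoulosII X2 = varopoulosII X2 \<circ> varopoulosII X1"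
  shows "onorm (matpoly_op P (varopoulosII X1) (varopoulosII X2)) \<le> matpoly_bidisc_norm P"
proof -
  let ?B = "matpoly_op P (varopoulosII X1) (varopoulosII X2)" and ?c = "matpoly_bidisc_norm P"
  have lin: "complex_linear X1" "complex_linear X2"
    using assms(2,3) by (auto intro: bounded_clinear_imp_complex_linear)
  have linear: "linear ?B"
    using assms(4,5)
    by (auto simp: contraction_def bounded_clinear_def intro: bounded_linear.linear bounded_linear_matpoly_op)
  have inner_le: "inner (?B v) w \<le> ?c / 2 * ((norm v)\<^sup>2 + (norm w)\<^sup>2)" for v w :: "('h ^ 3) ^ 'l"
  proof -
    let ?term = "\<lambda>k. inner (mat_tensor (Poly_Mapping.lookup P k)
      (varopoulosII X1 ^^ fst k \<circ> varopoulosII X2 ^^ snd k) v) w"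
    have "(\<lambda>N. \<Sum>k\<in>Poly_Mapping.keys P. (1 - real (snd k) / real N) * ?term k)
        \<longlonglongrightarrow> (\<Sum>k\<in>Poly_Mapping.keys P. (1 - 0) * ?term k)"
      by (intro tendsto_sum tendsto_mult tendsto_diff tendsto_const lim_const_over_n)
    moreover have "\<exists>N0. \<forall>N\<ge>N0. (\<Sum>k\<in>Poly_Mapping.keys P. (1 - real (snd k) / real N) * ?term k)
        \<le> ?c / 2 * ((norm v)\<^sup>2 + (norm w)\<^sup>2)"
      using fejer_mean_le[OF lin(1) varopoulosII_contractiveD[OF lin(1) assms(4)]
          lin(2) varopoulosII_contractiveD[OF lin(2) assms(5)] varopoulosII_commuteD[OF lin assms(6)]]
      by (intro exI[of _ 3] allI impI) (simp only: numeral_3_eq_3 numeral_2_eq_2 Suc_le_eq)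
    ultimately have "(\<Sum>k\<in>Poly_Mapping.keys P. (1 - 0) * ?term k)
        \<le> ?c / 2 * ((norm v)\<^sup>2 + (norm w)\<^sup>2)"
      by (rule LIMSEQ_le_const2)
    then show ?thesis
      by (simp add: matpoly_op_def case_prod_beta inner_sum_left)
  qed
  show ?thesis
    by (rule onorm_bound[OF matpoly_bidisc_norm_nonneg]) (rule norm_le_of_inner_le[OF linear inner_le])
qed

end
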